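(* Let $T$ be a self-adjoint operator acting in a separable Hilbert space $H$, with resolution of the identity $E_x$ ($x\in\mathbb{R}$), and let $G$ be the generating subspace of $T$. Let $\mathfrak{N}$ be a Hilbert space with $\dim\mathfrak{N}=\dim G$ and let $\psi:H\to\mathfrak{N}$ be a bounded linear operator from $H$ onto $\mathfrak{N}$ such that $\operatorname{Ker}\psi=H\ominus G$ and $\psi^*$ is invertible on $\mathfrak{N}$. Put $F(x)=\psi E_x\psi^*$. Then the operator $$V:L^2_{\mathbb{R}}(\mathfrak{N},dF)\to H,\qquad Vf(\cdot)=\int_{\mathbb{R}}dE_x\,\psi^*f(x),$$ is a unitary isomorphism between $L^2_{\mathbb{R}}(\mathfrak{N},dF)$ and $H$, and $$VQ=TV,$$ where $Q$ is the self-adjoint operator $(Qf)(x)=xf(x)$ in $L^2_{\mathbb{R}}(\mathfrak{N},dF)$ with domain $\mathfrak{D}_Q=\{f\in L^2_{\mathbb{R}}(\mathfrak{N},dF):xf(x)\in L^2_{\mathbb{R}}(\mathfrak{N},dF)\}$.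
   Context: Generating subspace: one chooses vectors $f_1,f_2,\dots$ in $H$ such that the subspaces $L_k=\overline{\operatorname{span}}\{E_\Delta f_k:\Delta\subset\mathbb{R}\text{ an interval}\}$ are mutually orthogonal ($f_{k+1}$ is taken in the orthogonal complement of $L_1\oplus\dots\oplus L_k$) and $H=\bigoplus_kL_k$. Then $G=\overline{\operatorname{span}}\{f_k:k\in\mathbb{N}\}$ is called a generating subspace of $T$, and $H=\overline{\operatorname{span}}\{E_\Delta g:g\in G,\ \Delta\subset\mathbb{R}\}$. $F(x)=\psi E_x\psi^*$ is a non-decreasing non-negative operator-valued function in $\mathfrak{N}$. The Hilbert space $$L^2_{\mathbb{R}}(\mathfrak{N},dF)=\Big\{f(x)\in\mathfrak{N}:\int_{\mathbb{R}}\langle dF(x)f(x),f(x)\rangle_{\mathfrak{N}}<\infty\Big\}$$ is obtained by closing the class of continuous $\mathfrak{N}$-valued functions (with finite norm) in this metric, followed by factorization by the kernel of the metric. The operator $V$ is given by the displayed integral, extended by continuity. *)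

theory Defs
  imports "HOL-Analysis.Analysis"
begin

section \<open>Complex Hilbert spaces\<close>

text \<open>The inner product is linear in its first argument.\<close>

class complex_hilbert_space = banach +
  fixes scaleC :: "complex \<Rightarrow> 'a \<Rightarrow> 'a" (infixr \<open>*\<^sub>C\<close> 75)
    and cinner :: "'a \<Rightarrow> 'a \<Rightarrow> complex"
  assumes scaleC_of_real: "scaleC (complex_of_real r) x = r *\<^sub>R x"
    and scaleC_add_right: "scaleC c (x + y) = scaleC c x + scaleC c y"
    and scaleC_add_left: "scaleC (c + d) x = scaleC c x + scaleC d x"
    and scaleC_scaleC: "scaleC c (scaleC d x) = scaleC (c * d) x"
    and cinner_commute: "cinner x y = cnj (cinner y x)"
    and cinner_add_left: "cinner (x + y) z = cinner x z + cinner y z"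
    and cinner_scaleC_left: "cinner (scaleC c x) y = c * cinner x y"
    and cinner_self: "cinner x x = complex_of_real ((norm x)\<^sup>2)"

definition csubspace :: "'a::complex_hilbert_space set \<Rightarrow> bool" where
  "csubspace S \<longleftrightarrow> 0 \<in> S \<and> (\<forall>x\<in>S. \<forall>y\<in>S. x + y \<in> S) \<and> (\<forall>c. \<forall>x\<in>S. c *\<^sub>C x \<in> S)"

definition closed_cspan :: "'a::complex_hilbert_space set \<Rightarrow> 'a set" where
  "closed_cspan S = closure (csubspace hull S)"

definition orth_compl :: "'a::complex_hilbert_space set \<Rightarrow> 'a set" where
  "orth_compl S = {x. \<forall>y\<in>S. cinner x y = 0}"

definition bounded_clinear ::
    "('a::complex_hilbert_space \<Rightarrow> 'b::complex_hilbert_space) \<Rightarrow> bool" where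
  "bounded_clinear A \<longleftrightarrow> bounded_linear A \<and> (\<forall>c x. A (c *\<^sub>C x) = c *\<^sub>C A x)"

definition cadjoint ::
    "('a::complex_hilbert_space \<Rightarrow> 'b::complex_hilbert_space) \<Rightarrow> 'b \<Rightarrow> 'a" where
  "cadjoint A = (THE B. \<forall>x y. cinner (A x) y = cinner x (B y))"

definition orthonormal_basis :: "'a::complex_hilbert_space set \<Rightarrow> 'a set \<Rightarrow> bool" where
  "orthonormal_basis B S \<longleftrightarrow>
     (\<forall>x\<in>B. norm x = 1) \<and> (\<forall>x\<in>B. \<forall>y\<in>B. x \<noteq> y \<longrightarrow> cinner x y = 0) \<and> closed_cspan B = S"

definition same_hilbert_dim ::
    "'a::complex_hilbert_space set \<Rightarrow> 'b::complex_hilbert_space set \<Rightarrow> bool" where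
  "same_hilbert_dim S R \<longleftrightarrow>
     (\<exists>B C. orthonormal_basis B S \<and> orthonormal_basis C R \<and> B \<approx> C)"


section \<open>Semi-inner product spaces on a carrier set, and their Hilbert completion\<close>

text \<open>The space \<open>L\<^sup>2(dF)\<close> depends on the term \<open>F\<close> and so cannot be a type; it is given by a
  carrier set with explicit operations. The form \<open>ip\<close> may have a nontrivial kernel.\<close>

record 'a ip_space =
  carrier :: "'a set"
  vadd :: "'a \<Rightarrow> 'a \<Rightarrow> 'a"
  vscale :: "complex \<Rightarrow> 'a \<Rightarrow> 'a"
  ip :: "'a \<Rightarrow> 'a \<Rightarrow> complex"

definition ipdist :: "('a, 'z) ip_space_scheme \<Rightarrow> 'a \<Rightarrow> 'a \<Rightarrow> real" where
  "ipdist P u v = (let w = vadd P u (vscale P (-1) v) in sqrt (Re (ip P w w)))"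

definition whole_space :: "'h::complex_hilbert_space ip_space" where
  "whole_space = \<lparr>carrier = UNIV, vadd = (+), vscale = scaleC, ip = cinner\<rparr>"

definition cauchy_seqs :: "'a ip_space \<Rightarrow> (nat \<Rightarrow> 'a) set" where
  "cauchy_seqs P = {X. (\<forall>n. X n \<in> carrier P) \<and>
     (\<forall>e>0. \<exists>N. \<forall>m\<ge>N. \<forall>n\<ge>N. ipdist P (X m) (X n) < e)}"

definition null_rel :: "'a ip_space \<Rightarrow> ((nat \<Rightarrow> 'a) \<times> (nat \<Rightarrow> 'a)) set" where
  "null_rel P = {(X, Y). X \<in> cauchy_seqs P \<and> Y \<in> cauchy_seqs P \<and>
     (\<lambda>n. ipdist P (X n) (Y n)) \<longlonglongrightarrow> 0}"

text \<open>Completion and factorization by the kernel of the form in one step: Cauchy sequences modulo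
  null sequences.\<close>

definition completion :: "'a ip_space \<Rightarrow> (nat \<Rightarrow> 'a) set ip_space" where
  "completion P =
     \<lparr>carrier = cauchy_seqs P // null_rel P,
      vadd = (\<lambda>A B. \<Union>X\<in>A. \<Union>Y\<in>B. null_rel P `` {\<lambda>n. vadd P (X n) (Y n)}),
      vscale = (\<lambda>c A. \<Union>X\<in>A. null_rel P `` {\<lambda>n. vscale P c (X n)}),
      ip = (\<lambda>A B. THE z. \<forall>X\<in>A. \<forall>Y\<in>B. (\<lambda>n. ip P (X n) (Y n)) \<longlonglongrightarrow> z)\<rparr>"

definition completion_emb :: "'a ip_space \<Rightarrow> 'a \<Rightarrow> (nat \<Rightarrow> 'a) set" where
  "completion_emb P u = null_rel P `` {\<lambda>_. u}"

definition unitary_iso :: "'a ip_space \<Rightarrow> 'b ip_space \<Rightarrow> ('a \<Rightarrow> 'b) \<Rightarrow> bool" where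
  "unitary_iso P R V \<longleftrightarrow> bij_betw V (carrier P) (carrier R) \<and>
     (\<forall>u\<in>carrier P. \<forall>v\<in>carrier P. V (vadd P u v) = vadd R (V u) (V v)) \<and>
     (\<forall>c. \<forall>u\<in>carrier P. V (vscale P c u) = vscale R c (V u)) \<and>
     (\<forall>u\<in>carrier P. \<forall>v\<in>carrier P. ip R (V u) (V v) = ip P u v)"

text \<open>A possibly unbounded operator is given by its domain \<open>D\<close> and a function \<open>T\<close> whose values
  outside \<open>D\<close> are irrelevant. The last conjunct says that \<open>T\<close> and its adjoint have the same
  graph.\<close>

definition self_adjoint :: "'a ip_space \<Rightarrow> 'a set \<Rightarrow> ('a \<Rightarrow> 'a) \<Rightarrow> bool" where
  "self_adjoint P D T \<longleftrightarrow> D \<subseteq> carrier P \<and> T ` D \<subseteq> carrier P \<and>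
     (\<forall>u\<in>D. \<forall>v\<in>D. vadd P u v \<in> D \<and> T (vadd P u v) = vadd P (T u) (T v)) \<and>
     (\<forall>c. \<forall>u\<in>D. vscale P c u \<in> D \<and> T (vscale P c u) = vscale P c (T u)) \<and>
     (\<forall>u\<in>carrier P. \<forall>e>0. \<exists>v\<in>D. ipdist P u v < e) \<and>
     (\<forall>v\<in>carrier P. \<forall>w\<in>carrier P.
        (\<forall>u\<in>D. ip P (T u) v = ip P u w) \<longleftrightarrow> (v \<in> D \<and> T v = w))"


section \<open>Riemann--Stieltjes integrals\<close>

definition increment :: "(real \<Rightarrow> 'a \<Rightarrow> 'b::ab_group_add) \<Rightarrow> real set \<Rightarrow> 'a \<Rightarrow> 'b" where
  "increment A K h = (if K = {} then 0 else A (Sup K) h - A (Inf K) h)"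

text \<open>Tagged partitions of \<open>[a,b]\<close> with mesh tending to zero.\<close>

definition rs_filter :: "real \<Rightarrow> real \<Rightarrow> (real \<times> real set) set filter" where
  "rs_filter a b = (INF \<delta>\<in>{0<..}.
     principal {p. p tagged_division_of {a..b} \<and> (\<lambda>x. ball x \<delta>) fine p})"

text \<open>The integral over \<open>\<real>\<close> is improper: \<open>a \<rightarrow> -\<infinity>\<close>, \<open>b \<rightarrow> \<infinity>\<close>. The integrand \<open>I x K\<close> is a function of
  the tag \<open>x\<close> and the interval \<open>K\<close>.\<close>

definition has_rs_integral :: "(real \<Rightarrow> real set \<Rightarrow> 'v::real_normed_vector) \<Rightarrow> 'v \<Rightarrow> bool" where
  "has_rs_integral I y \<longleftrightarrow> (\<exists>J.
     (\<forall>a b. a < b \<longrightarrow> ((\<lambda>p. \<Sum>(x, K)\<in>p. I x K) \<longlongrightarrow> J a b) (rs_filter a b)) \<and>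
     ((\<lambda>(a, b). J a b) \<longlongrightarrow> y) (at_bot \<times>\<^sub>F at_top))"


section \<open>Resolutions of the identity\<close>

text \<open>Normalised to be right-continuous, i.e. \<open>E x\<close> is the projection belonging to \<open>(-\<infinity>, x]\<close>.\<close>

definition resolution_of_identity :: "(real \<Rightarrow> 'h::complex_hilbert_space \<Rightarrow> 'h) \<Rightarrow> bool" where
  "resolution_of_identity E \<longleftrightarrow>
     (\<forall>x. bounded_clinear (E x)) \<and>
     (\<forall>x u v. cinner (E x u) v = cinner u (E x v)) \<and>
     (\<forall>x y u. E x (E y u) = E (min x y) u) \<and>
     (\<forall>x u. ((\<lambda>y. E y u) \<longlongrightarrow> E x u) (at_right x)) \<and>
     (\<forall>u. ((\<lambda>y. E y u) \<longlongrightarrow> 0) at_bot) \<and>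
     (\<forall>u. ((\<lambda>y. E y u) \<longlongrightarrow> u) at_top)"

text \<open>\<open>T = \<integral> x dE\<^sub>x\<close>, with domain the vectors \<open>h\<close> such that \<open>\<integral> x\<^sup>2 d\<langle>E\<^sub>x h, h\<rangle> < \<infinity>\<close>.\<close>

definition resolution_of_operator ::
    "(real \<Rightarrow> 'h::complex_hilbert_space \<Rightarrow> 'h) \<Rightarrow> 'h set \<Rightarrow> ('h \<Rightarrow> 'h) \<Rightarrow> bool" where
  "resolution_of_operator E D T \<longleftrightarrow> resolution_of_identity E \<and>
     D = {h. \<exists>s. has_rs_integral (\<lambda>x K. of_real (x\<^sup>2) * cinner (increment E K h) h) s} \<and>
     (\<forall>h\<in>D. has_rs_integral (\<lambda>x K. x *\<^sub>R increment E K h) (T h))"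

text \<open>For a down-closed set \<open>D\<close> of reals this is the projection belonging to \<open>D\<close>, the strong limit of
  \<open>E x\<close> as \<open>x\<close> increases in \<open>D\<close>: it is \<open>E b\<close> for \<open>D = (-\<infinity>, b]\<close>, the left limit of \<open>E\<close> at \<open>b\<close> for
  \<open>D = (-\<infinity>, b)\<close>, and the identity for \<open>D = \<real>\<close>.\<close>

definition E_ray :: "(real \<Rightarrow> 'h::complex_hilbert_space \<Rightarrow> 'h) \<Rightarrow> real set \<Rightarrow> 'h \<Rightarrow> 'h" where
  "E_ray E D h = (if D = {} then 0 else Lim (INF x\<in>D. principal (D \<inter> {x..})) (\<lambda>x. E x h))"

text \<open>\<open>E\<^sub>\<Delta>\<close> for an arbitrary interval \<open>\<Delta>\<close>, as a difference of two rays.\<close>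

definition E_interval :: "(real \<Rightarrow> 'h::complex_hilbert_space \<Rightarrow> 'h) \<Rightarrow> real set \<Rightarrow> 'h \<Rightarrow> 'h" where
  "E_interval E \<Delta> h =
     (let D = {x. \<exists>y\<in>\<Delta>. x \<le> y} in E_ray E D h - E_ray E (D - \<Delta>) h)"

text \<open>The sequence \<open>f\<close> may contain zero vectors, which covers finitely many \<open>f\<^sub>k\<close>.\<close>

definition generating_subspace ::
    "(real \<Rightarrow> 'h::complex_hilbert_space \<Rightarrow> 'h) \<Rightarrow> 'h set \<Rightarrow> bool" where
  "generating_subspace E G \<longleftrightarrow> (\<exists>(f :: nat \<Rightarrow> 'h) L.
     (\<forall>k. L k = closed_cspan {E_interval E \<Delta> (f k) |\<Delta>. is_interval \<Delta>}) \<and>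
     (\<forall>j k. j \<noteq> k \<longrightarrow> (\<forall>u\<in>L j. \<forall>v\<in>L k. cinner u v = 0)) \<and>
     closed_cspan (\<Union>k. L k) = UNIV \<and>
     G = closed_cspan (range f))"


section \<open>The space $L^2_{\mathbb R}(\mathfrak N, dF)$\<close>

text \<open>On \<open>[a,b]\<close> the integral of \<open>\<langle>dF f, g\<rangle>\<close> is the limit of the inner products of the Riemann step
  functions \<open>\<Sum> f(x) \<chi>\<^sub>K\<close> and \<open>\<Sum> g(y) \<chi>\<^sub>L\<close> in the metric of \<open>dF\<close>, i.e. of
  \<open>\<Sum>\<Sum> \<langle>F(K \<inter> L) f(x), g(y)\<rangle>\<close>, over two tagged partitions \<open>p, q\<close> refined independently. Where it
  exists it equals the limit of the usual sums \<open>\<Sum> \<langle>F(K) f(x), g(x)\<rangle>\<close>, the case \<open>p = q\<close>. For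
  infinite-dimensional values continuity of \<open>f\<close> on \<open>[a,b]\<close> does not imply existence; requiring
  it for independent \<open>p, q\<close> makes the step functions of \<open>f\<close> a Cauchy net, so that the functions of
  finite norm form a vector space.\<close>

definition F_sum :: "(real \<Rightarrow> 'n::complex_hilbert_space \<Rightarrow> 'n) \<Rightarrow> (real \<Rightarrow> 'n) \<Rightarrow> (real \<Rightarrow> 'n) \<Rightarrow>
    (real \<times> real set) set \<Rightarrow> (real \<times> real set) set \<Rightarrow> complex" where
  "F_sum F f g p q =
     (\<Sum>(x, K)\<in>p. \<Sum>(y, L)\<in>q. cinner (increment F (K \<inter> L) (f x)) (g y))"

definition has_F_integral :: "(real \<Rightarrow> 'n::complex_hilbert_space \<Rightarrow> 'n) \<Rightarrow> real \<Rightarrow> real \<Rightarrow>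
    (real \<Rightarrow> 'n) \<Rightarrow> (real \<Rightarrow> 'n) \<Rightarrow> complex \<Rightarrow> bool" where
  "has_F_integral F a b f g z \<longleftrightarrow>
     ((\<lambda>(p, q). F_sum F f g p q) \<longlongrightarrow> z) (rs_filter a b \<times>\<^sub>F rs_filter a b)"

definition F_integral_on :: "(real \<Rightarrow> 'n::complex_hilbert_space \<Rightarrow> 'n) \<Rightarrow> real \<Rightarrow> real \<Rightarrow>
    (real \<Rightarrow> 'n) \<Rightarrow> (real \<Rightarrow> 'n) \<Rightarrow> complex" where
  "F_integral_on F a b f g = (THE z. has_F_integral F a b f g z)"

definition F_integral :: "(real \<Rightarrow> 'n::complex_hilbert_space \<Rightarrow> 'n) \<Rightarrow>
    (real \<Rightarrow> 'n) \<Rightarrow> (real \<Rightarrow> 'n) \<Rightarrow> complex" where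
  "F_integral F f g = Lim (at_bot \<times>\<^sub>F at_top) (\<lambda>(a, b). F_integral_on F a b f g)"

definition finite_norm ::
    "(real \<Rightarrow> 'n::complex_hilbert_space \<Rightarrow> 'n) \<Rightarrow> (real \<Rightarrow> 'n) \<Rightarrow> bool" where
  "finite_norm F f \<longleftrightarrow>
     (\<forall>a b. a < b \<longrightarrow> (\<exists>z. has_F_integral F a b f f z)) \<and>
     (\<exists>z. ((\<lambda>(a, b). F_integral_on F a b f f) \<longlongrightarrow> z) (at_bot \<times>\<^sub>F at_top))"

definition C_space ::
    "(real \<Rightarrow> 'n::complex_hilbert_space \<Rightarrow> 'n) \<Rightarrow> (real \<Rightarrow> 'n) ip_space" where
  "C_space F =
     \<lparr>carrier = {f. continuous_on UNIV f \<and> finite_norm F f},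
      vadd = (\<lambda>f g x. f x + g x), vscale = (\<lambda>c f x. c *\<^sub>C f x), ip = F_integral F\<rparr>"

definition L2_space ::
    "(real \<Rightarrow> 'n::complex_hilbert_space \<Rightarrow> 'n) \<Rightarrow> (nat \<Rightarrow> real \<Rightarrow> 'n) set ip_space" where
  "L2_space F = completion (C_space F)"

text \<open>The relation \<open>g(x) = x f(x)\<close> between elements \<open>f = [X]\<close>, \<open>g = [Y]\<close> of the completion: on every
  bounded interval \<open>Y\<^sub>n(x) - x X\<^sub>n(x)\<close> tends to zero in the metric of \<open>dF\<close>. (Multiplication by \<open>x\<close> is
  bounded over a bounded interval, so the choice of the representatives does not matter.)\<close>

definition is_x_times :: "(real \<Rightarrow> 'n::complex_hilbert_space \<Rightarrow> 'n) \<Rightarrow>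
    (nat \<Rightarrow> real \<Rightarrow> 'n) set \<Rightarrow> (nat \<Rightarrow> real \<Rightarrow> 'n) set \<Rightarrow> bool" where
  "is_x_times F A B \<longleftrightarrow> (\<forall>X\<in>A. \<forall>Y\<in>B. \<forall>a b. a < b \<longrightarrow>
     (\<lambda>n. F_integral_on F a b (\<lambda>x. Y n x - x *\<^sub>R X n x) (\<lambda>x. Y n x - x *\<^sub>R X n x)) \<longlonglongrightarrow> 0)"

definition Q_dom ::
    "(real \<Rightarrow> 'n::complex_hilbert_space \<Rightarrow> 'n) \<Rightarrow> (nat \<Rightarrow> real \<Rightarrow> 'n) set set" where
  "Q_dom F = {A \<in> carrier (L2_space F). \<exists>B\<in>carrier (L2_space F). is_x_times F A B}"

definition Q_op :: "(real \<Rightarrow> 'n::complex_hilbert_space \<Rightarrow> 'n) \<Rightarrow>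
    (nat \<Rightarrow> real \<Rightarrow> 'n) set \<Rightarrow> (nat \<Rightarrow> real \<Rightarrow> 'n) set" where
  "Q_op F A = (THE B. B \<in> carrier (L2_space F) \<and> is_x_times F A B)"


section \<open>The operator $V$\<close>

definition V_pre :: "(real \<Rightarrow> 'h::complex_hilbert_space \<Rightarrow> 'h) \<Rightarrow>
    ('h \<Rightarrow> 'n::complex_hilbert_space) \<Rightarrow> (real \<Rightarrow> 'n) \<Rightarrow> 'h" where
  "V_pre E \<psi> f = (THE y. has_rs_integral (\<lambda>x K. increment E K (cadjoint \<psi> (f x))) y)"

text \<open>Extension by continuity from the continuous functions of finite norm.\<close>

definition V_op :: "(real \<Rightarrow> 'h::complex_hilbert_space \<Rightarrow> 'h) \<Rightarrow>
    ('h \<Rightarrow> 'n::complex_hilbert_space) \<Rightarrow> (nat \<Rightarrow> real \<Rightarrow> 'n) set \<Rightarrow> 'h" where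
  "V_op E \<psi> A = (THE h. \<forall>X\<in>A. (\<lambda>n. V_pre E \<psi> (X n)) \<longlonglongrightarrow> h)"

end

theory Submission
  imports Defs
begin

text \<open>
  For a closed interval \<open>K\<close> let \<open>E(K)\<close> be the increment of \<open>E\<close> over \<open>K\<close>.  These are projections with
  \<open>E(K) E(L) = E(K \<inter> L)\<close>, and those of intervals that do not overlap are orthogonal.  Writing
  \<open>u\<^sub>p(f)\<close> for the Riemann--Stieltjes sum of \<open>\<integral> dE\<^sub>x \<psi>\<^sup>* f(x)\<close> over a tagged partition \<open>p\<close>, one gets
  that the double sum over \<open>p\<close> and \<open>q\<close> defining the \<open>dF\<close>-integral of \<open>f\<close> and \<open>g\<close> is the inner
  product of \<open>u\<^sub>p(f)\<close> and \<open>u\<^sub>q(g)\<close> (\<open>F_sum_eq\<close>).  So it has a limit for \<open>f = g\<close> if and only if the net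
  \<open>u\<^sub>p(f)\<close> is Cauchy, and a function has finite norm if and only if \<open>V f = \<integral> dE\<^sub>x \<psi>\<^sup>* f(x)\<close> exists
  over the line (\<open>finite_norm_iff\<close>).  This makes \<open>V\<close> an isometry on the continuous functions of
  finite norm, and its extension to the completion is unitary as soon as its range is dense
  (\<open>unitary_extension\<close>).

  The closure of the range is a closed subspace.  The kernel of \<open>\<psi>\<close> is the orthogonal complement of
  \<open>G\<close>, and the range of \<open>\<psi>\<^sup>*\<close> is closed because \<open>\<psi>\<^sup>*\<close> has a bounded left inverse; hence each
  \<open>g \<in> G\<close> is \<open>\<psi>\<^sup>* n\<close> for some \<open>n\<close> (\<open>generating_in_range_adjoint\<close>).  For a bounded continuous scalar
  function \<open>\<phi>\<close> the function \<open>\<phi>(x) n\<close> is in the domain of \<open>V\<close>, and letting \<open>\<phi>\<close> tend to the indicator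
  function of \<open>(-\<infinity>, b]\<close> from the right one finds \<open>E\<^sub>b g\<close> in the closure of the range
  (\<open>integral_cutoff_approx\<close>).  Strong limits of these are all the vectors \<open>E\<^sub>\<Delta> f\<^sub>k\<close>, and they span \<open>H\<close>.

  Multiplication by \<open>x\<close> is intertwined with \<open>T\<close> interval by interval.  If the sums \<open>u\<^sub>p(f)\<close> converge
  on a bounded interval, those of \<open>x f(x)\<close> converge to the truncated operator \<open>\<integral> x dE\<^sub>x\<close> applied to
  the limit (\<open>tendsto_rsum_scaleR\<close>).  Therefore \<open>B\<close> is \<open>x\<close> times \<open>A\<close> if and only if, for all
  \<open>a < b\<close>, the truncation of \<open>\<integral> x dE\<^sub>x\<close> to \<open>[a, b]\<close> sends \<open>V A\<close> to the increment of \<open>V B\<close>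
  (\<open>is_x_times_iff\<close>), and this is exactly the description of \<open>V A \<in> D\<^sub>T\<close> and \<open>T V A = V B\<close>
  (\<open>resolution_of_operator_iff\<close>).  Self-adjointness of \<open>Q\<close> is then transported from \<open>T\<close>.
\<close>

section \<open>Complex Hilbert spaces\<close>

lemma cinner_add_right: "cinner x (y + z) = cinner x y + cinner x z"
  by (metis cinner_add_left cinner_commute complex_cnj_add)

lemma cinner_scaleC_right: "cinner x (c *\<^sub>C y) = cnj c * cinner x y"
  by (metis cinner_commute cinner_scaleC_left complex_cnj_mult)

lemma cinner_scaleR_left: "cinner (r *\<^sub>R x) y = r *\<^sub>R cinner x y"
  by (metis cinner_scaleC_left scaleC_of_real scaleR_conv_of_real)

lemma cinner_scaleR_right: "cinner x (r *\<^sub>R y) = r *\<^sub>R cinner x y"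
  by (metis cinner_scaleC_right scaleC_of_real scaleR_conv_of_real complex_cnj_complex_of_real)

lemma scaleC_minus_one: "(-1) *\<^sub>C x = - x"
  using scaleC_of_real[of "-1" x] by simp

lemma cinner_zero_left [simp]: "cinner 0 y = 0"
  using cinner_scaleR_left[of 0 0 y] by simp

lemma cinner_zero_right [simp]: "cinner y 0 = 0"
  using cinner_scaleR_right[of y 0 0] by simp

lemma cinner_minus_left: "cinner (- x) y = - cinner x y"
  using cinner_scaleR_left[of "-1" x y] by simp

lemma cinner_minus_right: "cinner x (- y) = - cinner x y"
  using cinner_scaleR_right[of x "-1" y] by simp

lemma cinner_diff_left: "cinner (x - y) z = cinner x z - cinner y z"
  using cinner_add_left[of x "-y" z] cinner_minus_left[of y z] by simp

lemma cinner_diff_right: "cinner x (y - z) = cinner x y - cinner x z"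
  using cinner_add_right[of x y "-z"] cinner_minus_right[of x z] by simp

text \<open>Subtracting from \<open>x\<close> its component along \<open>y\<close>.  Non-negativity of the left-hand side is the
  Cauchy--Schwarz inequality.\<close>

lemma norm_diff_component_sq:
  assumes "y \<noteq> 0"
  shows "(norm (x - (cinner x y / (norm y)\<^sup>2) *\<^sub>C y))\<^sup>2 = (norm x)\<^sup>2 - (cmod (cinner x y))\<^sup>2 / (norm y)\<^sup>2"
proof -
  define c where "c = cinner x y / (norm y)\<^sup>2"
  define s where "s = cinner x y"
  have yx: "cinner y x = cnj s"
    unfolding s_def by (rule cinner_commute)
  have ny: "complex_of_real ((norm y)\<^sup>2) \<noteq> 0" using assms by simp
  have "complex_of_real ((norm (x - c *\<^sub>C y))\<^sup>2) = cinner (x - c *\<^sub>C y) (x - c *\<^sub>C y)"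
    by (simp add: cinner_self)
  also have "\<dots> = cinner x x - cnj c * s - c * (cnj s - cnj c * cinner y y)"
    by (simp add: cinner_diff_left cinner_diff_right cinner_scaleC_left cinner_scaleC_right yx
        s_def[symmetric] algebra_simps)
  also have "\<dots> = complex_of_real ((norm x)\<^sup>2) - s * cnj s / complex_of_real ((norm y)\<^sup>2)"
    using ny by (simp add: cinner_self c_def s_def[symmetric] field_simps)
  also have "\<dots> = complex_of_real ((norm x)\<^sup>2 - (cmod s)\<^sup>2 / (norm y)\<^sup>2)"
    by (simp add: complex_norm_square[symmetric])
  finally show ?thesis
    unfolding c_def s_def using of_real_eq_iff by blast
qed

lemma cinner_cauchy_schwarz: "cmod (cinner x y) \<le> norm x * norm y"
proof (cases "y = 0")
  case False
  have "0 \<le> (norm x)\<^sup>2 - (cmod (cinner x y))\<^sup>2 / (norm y)\<^sup>2"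
    using norm_diff_component_sq[OF False, of x] zero_le_power2 by metis
  then have "(cmod (cinner x y))\<^sup>2 \<le> (norm x * norm y)\<^sup>2"
    using False by (simp add: field_simps power_mult_distrib)
  then show ?thesis
    by (rule power2_le_imp_le) simp
qed simp

interpretation cinner: bounded_bilinear "cinner :: 'a::complex_hilbert_space \<Rightarrow> 'a \<Rightarrow> complex"
proof
  show "\<exists>K. \<forall>a b. cmod (cinner (a::'a) b) \<le> norm a * norm b * K"
    by (rule exI[of _ 1]) (simp add: cinner_cauchy_schwarz)
qed (simp_all add: cinner_add_left cinner_add_right cinner_scaleR_left cinner_scaleR_right)

lemma cinner_eq_zero_iff [simp]: "cinner x x = 0 \<longleftrightarrow> x = 0"
  by (simp add: cinner_self)

lemma cinner_eqI: "(\<And>z. cinner z x = cinner z y) \<Longrightarrow> x = y"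
  by (metis cinner.diff_right cinner_eq_zero_iff right_minus_eq)

lemma norm_sq_cinner: "(norm x)\<^sup>2 = Re (cinner x x)"
  by (simp add: cinner_self)

lemma norm_add_sq: "(norm (x + y))\<^sup>2 = (norm x)\<^sup>2 + (norm y)\<^sup>2 + 2 * Re (cinner x y)"
  unfolding norm_sq_cinner using cinner_commute[of y x]
  by (simp add: cinner_add_left cinner_add_right)

lemma norm_diff_sq: "(norm (x - y))\<^sup>2 = (norm x)\<^sup>2 + (norm y)\<^sup>2 - 2 * Re (cinner x y)"
  using norm_add_sq[of x "-y"] by (simp add: cinner_minus_right)

lemma norm_scaleC: "norm (c *\<^sub>C x) = cmod c * norm x"
proof -
  have "complex_of_real ((norm (c *\<^sub>C x))\<^sup>2) = c * cnj c * complex_of_real ((norm x)\<^sup>2)"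
    unfolding cinner_self[symmetric] by (simp add: cinner_scaleC_left cinner_scaleC_right)
  also have "\<dots> = complex_of_real ((cmod c * norm x)\<^sup>2)"
    by (simp add: complex_norm_square[symmetric] power_mult_distrib)
  finally have "(norm (c *\<^sub>C x))\<^sup>2 = (cmod c * norm x)\<^sup>2"
    using of_real_eq_iff by blast
  then show ?thesis by (simp add: power2_eq_iff_nonneg)
qed

lemma bounded_linear_scaleC: "bounded_linear ((*\<^sub>C) c :: 'a::complex_hilbert_space \<Rightarrow> 'a)"
proof
  show "c *\<^sub>C (r *\<^sub>R x) = r *\<^sub>R c *\<^sub>C x" for r and x :: 'a
    by (simp add: scaleC_of_real[symmetric] scaleC_scaleC mult.commute)
  show "\<exists>K. \<forall>x::'a. norm (c *\<^sub>C x) \<le> norm x * K"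
    by (rule exI[of _ "cmod c"]) (simp add: norm_scaleC mult.commute)
qed (rule scaleC_add_right)

lemmas tendsto_scaleC = bounded_linear.tendsto[OF bounded_linear_scaleC]

lemma csubspaceD:
  assumes "csubspace M"
  shows csubspace_zero: "0 \<in> M"
    and csubspace_add: "x \<in> M \<Longrightarrow> y \<in> M \<Longrightarrow> x + y \<in> M"
    and csubspace_scaleC: "x \<in> M \<Longrightarrow> c *\<^sub>C x \<in> M"
    and csubspace_diff: "x \<in> M \<Longrightarrow> y \<in> M \<Longrightarrow> x - y \<in> M"
    and csubspace_scaleR: "x \<in> M \<Longrightarrow> r *\<^sub>R x \<in> M"
proof -
  show "0 \<in> M" and add: "x \<in> M \<Longrightarrow> y \<in> M \<Longrightarrow> x + y \<in> M" and sc: "x \<in> M \<Longrightarrow> c *\<^sub>C x \<in> M" for x y c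
    using assms by (auto simp: csubspace_def)
  show "x \<in> M \<Longrightarrow> y \<in> M \<Longrightarrow> x - y \<in> M"
    using add[of x "(-1) *\<^sub>C y"] sc[of y "-1"] by (simp add: scaleC_minus_one)
  show "x \<in> M \<Longrightarrow> r *\<^sub>R x \<in> M"
    by (metis sc scaleC_of_real)
qed

lemma csubspace_closure:
  assumes "csubspace M"
  shows "csubspace (closure M)"
  unfolding csubspace_def
proof (intro conjI ballI allI)
  show "0 \<in> closure M"
    using csubspace_zero[OF assms] closure_subset by blast
next
  fix x y assume "x \<in> closure M" "y \<in> closure M"
  then obtain X Y where "\<forall>n. X n \<in> M" "X \<longlonglongrightarrow> x" "\<forall>n. Y n \<in> M" "Y \<longlonglongrightarrow> y"
    unfolding closure_sequential by blast
  then have "\<forall>n. X n + Y n \<in> M" "(\<lambda>n. X n + Y n) \<longlonglongrightarrow> x + y"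
    using csubspace_add[OF assms] by (auto intro: tendsto_add)
  then show "x + y \<in> closure M"
    unfolding closure_sequential by (intro exI[of _ "\<lambda>n. X n + Y n"]) simp
next
  fix c x assume "x \<in> closure M"
  then obtain X where "\<forall>n. X n \<in> M" "X \<longlonglongrightarrow> x"
    unfolding closure_sequential by blast
  then have "\<forall>n. c *\<^sub>C X n \<in> M" "(\<lambda>n. c *\<^sub>C X n) \<longlonglongrightarrow> c *\<^sub>C x"
    using csubspace_scaleC[OF assms] by (auto intro: tendsto_scaleC)
  then show "c *\<^sub>C x \<in> closure M"
    unfolding closure_sequential by (intro exI[of _ "\<lambda>n. c *\<^sub>C X n"]) simp
qed

lemma closed_cspan_minimal:
  assumes "csubspace M" "closed M" "S \<subseteq> M"
  shows "closed_cspan S \<subseteq> M"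
  unfolding closed_cspan_def
  by (intro closure_minimal hull_minimal assms)

lemma closed_cspan_superset: "S \<subseteq> closed_cspan S"
  unfolding closed_cspan_def by (meson closure_subset hull_subset subset_trans)

text \<open>A minimizing sequence for the distance from \<open>x\<close> to \<open>M\<close> is Cauchy by the parallelogram law.\<close>

lemma orthogonal_projection_exists:
  fixes M :: "'a::complex_hilbert_space set"
  assumes M: "csubspace M" "closed M"
  shows "\<exists>m\<in>M. \<forall>y\<in>M. cinner (x - m) y = 0"
proof -
  define d where "d = infdist x M"
  have ne: "M \<noteq> {}" using csubspace_zero[OF M(1)] by auto
  have d0: "0 \<le> d" unfolding d_def by (rule infdist_nonneg)
  have dle: "d \<le> norm (x - m)" if "m \<in> M" for m
    unfolding d_def using infdist_le[OF that, of x] by (simp add: dist_norm)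
  have "\<exists>m\<in>M. norm (x - m) < d + 1 / real (Suc n)" for n
  proof (rule ccontr)
    assume "\<not> ?thesis"
    then have "d + 1 / real (Suc n) \<le> dist x m" if "m \<in> M" for m
      using that by (force simp: dist_norm)
    then have "d + 1 / real (Suc n) \<le> d"
      using cINF_greatest[OF ne, of "d + 1 / real (Suc n)" "dist x"] infdist_notempty[OF ne, of x]
      unfolding d_def by simp
    then show False by simp
  qed
  then obtain m where mM: "\<And>n. m n \<in> M" and mlt: "\<And>n. norm (x - m n) < d + 1 / real (Suc n)"
    by metis
  have key: "(norm (m i - m j))\<^sup>2 \<le> 2 * (norm (x - m i))\<^sup>2 + 2 * (norm (x - m j))\<^sup>2 - 4 * d\<^sup>2" for i j
  proof -
    let ?u = "x - m i" and ?v = "x - m j"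
    have "(1/2) *\<^sub>R (m i + m j) \<in> M"
      by (intro csubspace_scaleR csubspace_add M mM)
    then have "d \<le> norm (x - (1/2) *\<^sub>R (m i + m j))" by (rule dle)
    also have "x - (1/2) *\<^sub>R (m i + m j) = (1/2) *\<^sub>R (?u + ?v)"
      by (simp add: algebra_simps scaleR_2[symmetric])
    finally have "d \<le> norm (?u + ?v) / 2" by simp
    then have "d\<^sup>2 \<le> (norm (?u + ?v) / 2)\<^sup>2" using d0 by (rule power_mono)
    then have "4 * d\<^sup>2 \<le> (norm (?u + ?v))\<^sup>2" by (simp add: power_divide)
    moreover have "norm (m i - m j) = norm (?u - ?v)" by (simp add: norm_minus_commute)
    ultimately show ?thesis
      using norm_add_sq[of ?u ?v] norm_diff_sq[of ?u ?v] by simp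
  qed
  have up: "(\<lambda>n. norm (x - m n)) \<longlonglongrightarrow> d"
  proof (rule tendsto_sandwich)
    show "eventually (\<lambda>n. d \<le> norm (x - m n)) sequentially"
      using dle[OF mM] by simp
    show "eventually (\<lambda>n. norm (x - m n) \<le> d + 1 / real (Suc n)) sequentially"
      using mlt by (intro always_eventually allI less_imp_le)
    show "(\<lambda>n. d + 1 / real (Suc n)) \<longlonglongrightarrow> d"
      using tendsto_add[OF tendsto_const LIMSEQ_inverse_real_of_nat, of d] by (simp add: divide_inverse)
  qed simp
  have sq: "(\<lambda>n. (norm (x - m n))\<^sup>2) \<longlonglongrightarrow> d\<^sup>2" by (intro tendsto_power up)
  have "Cauchy m"
  proof (rule metric_CauchyI)
    fix e :: real assume e: "e > 0"
    then have "eventually (\<lambda>n. (norm (x - m n))\<^sup>2 < d\<^sup>2 + e\<^sup>2 / 4) sequentially"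
      by (intro order_tendstoD[OF sq]) simp
    then obtain N where N: "\<And>n. n \<ge> N \<Longrightarrow> (norm (x - m n))\<^sup>2 < d\<^sup>2 + e\<^sup>2 / 4"
      unfolding eventually_sequentially by auto
    show "\<exists>N. \<forall>i\<ge>N. \<forall>j\<ge>N. dist (m i) (m j) < e"
    proof (intro exI allI impI)
      fix i j assume "i \<ge> N" "j \<ge> N"
      then have "(norm (m i - m j))\<^sup>2 < e\<^sup>2"
        using key[of i j] N[of i] N[of j] by linarith
      then show "dist (m i) (m j) < e"
        unfolding dist_norm using e by (simp add: power_less_imp_less_base)
    qed
  qed
  then obtain l where l: "m \<longlonglongrightarrow> l" using Cauchy_convergent convergent_def by blast
  have lM: "l \<in> M" using closed_sequentially[OF M(2) _ l] mM by blast
  have "(\<lambda>n. norm (x - m n)) \<longlonglongrightarrow> norm (x - l)" by (intro tendsto_intros l)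
  then have nl: "norm (x - l) = d" using up LIMSEQ_unique by blast
  have "cinner (x - l) y = 0" if y: "y \<in> M" for y
  proof (cases "y = 0")
    case False
    let ?c = "cinner (x - l) y / (norm y)\<^sup>2"
    have "l + ?c *\<^sub>C y \<in> M" by (intro csubspace_add csubspace_scaleC M lM y)
    then have "d \<le> norm (x - (l + ?c *\<^sub>C y))" by (rule dle)
    then have "d\<^sup>2 \<le> (norm ((x - l) - ?c *\<^sub>C y))\<^sup>2" using d0 by (simp add: power_mono algebra_simps)
    also have "\<dots> = d\<^sup>2 - (cmod (cinner (x - l) y))\<^sup>2 / (norm y)\<^sup>2"
      using norm_diff_component_sq[OF False, of "x - l"] nl by simp
    finally have "(cmod (cinner (x - l) y))\<^sup>2 / (norm y)\<^sup>2 \<le> 0" by simp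
    then show ?thesis using False
      by (smt (verit) divide_pos_pos norm_eq_zero zero_less_norm_iff zero_less_power2)
  qed simp
  then show ?thesis using lM by blast
qed

lemma riesz_representation:
  fixes \<phi> :: "'a::complex_hilbert_space \<Rightarrow> complex"
  assumes bl: "bounded_linear \<phi>" and sc: "\<And>c x. \<phi> (c *\<^sub>C x) = c * \<phi> x"
  shows "\<exists>y. \<forall>x. \<phi> x = cinner x y"
proof (cases "\<forall>x. \<phi> x = 0")
  case False
  then obtain x0 where x0: "\<phi> x0 \<noteq> 0" by blast
  interpret bounded_linear \<phi> by (rule bl)
  define M where "M = {x. \<phi> x = 0}"
  have M: "csubspace M" unfolding csubspace_def M_def by (auto simp: add sc zero)
  have "closed M"
    unfolding M_def by (intro closed_Collect_eq continuous_intros linear_continuous_on bl)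
  then obtain m where m: "m \<in> M" "\<And>y. y \<in> M \<Longrightarrow> cinner (x0 - m) y = 0"
    using orthogonal_projection_exists[OF M, of x0] by blast
  define z where "z = x0 - m"
  have pz: "\<phi> z \<noteq> 0" using x0 m(1) by (simp add: z_def diff M_def)
  then have z0: "z \<noteq> 0" using zero by auto
  show ?thesis
  proof (intro exI allI)
    fix x
    have "\<phi> z *\<^sub>C x - \<phi> x *\<^sub>C z \<in> M" by (simp add: M_def diff sc)
    then have "cinner z (\<phi> z *\<^sub>C x - \<phi> x *\<^sub>C z) = 0" unfolding z_def by (rule m(2))
    then have "cinner (\<phi> z *\<^sub>C x - \<phi> x *\<^sub>C z) z = 0" by (metis cinner_commute complex_cnj_zero)
    then have "\<phi> z * cinner x z = \<phi> x * (norm z)\<^sup>2"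
      by (simp add: cinner_diff_left cinner_scaleC_left cinner_self)
    then show "\<phi> x = cinner x ((cnj (\<phi> z) / (norm z)\<^sup>2) *\<^sub>C z)"
      using z0 by (simp add: cinner_scaleC_right field_simps)
  qed
next
  case True
  then show ?thesis by (intro exI[of _ 0]) simp
qed

lemma cinner_cadjoint:
  fixes A :: "'a::complex_hilbert_space \<Rightarrow> 'b::complex_hilbert_space"
  assumes "bounded_clinear A"
  shows "cinner (A x) y = cinner x (cadjoint A y)"
proof -
  have bl: "bounded_linear A" and sc: "\<And>c x. A (c *\<^sub>C x) = c *\<^sub>C A x"
    using assms by (auto simp: bounded_clinear_def)
  have "\<exists>z. \<forall>x. cinner (A x) y = cinner x z" for y
    by (rule riesz_representation)
      (auto simp: sc cinner_scaleC_left intro: bounded_linear_compose[OF cinner.bounded_linear_left bl])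
  then obtain B where B: "\<And>x y. cinner (A x) y = cinner x (B y)" by metis
  have "\<forall>x y. cinner (A x) y = cinner x (cadjoint A y)"
    unfolding cadjoint_def
  proof (rule theI[where a = B])
    fix C assume C: "\<forall>x y. cinner (A x) y = cinner x (C y)"
    show "C = B"
    proof
      fix y show "C y = B y" by (rule cinner_eqI) (metis B C)
    qed
  qed (use B in blast)
  then show ?thesis by blast
qed

lemma bounded_clinear_cadjoint:
  fixes A :: "'a::complex_hilbert_space \<Rightarrow> 'b::complex_hilbert_space"
  assumes A: "bounded_clinear A"
  shows "bounded_clinear (cadjoint A)"
proof -
  note adj = cinner_cadjoint[OF A, symmetric]
  obtain K where K: "\<And>x. norm (A x) \<le> norm x * K" and K0: "0 \<le> K"
    using A bounded_linear.nonneg_bounded unfolding bounded_clinear_def by blast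
  have add: "cadjoint A (x + y) = cadjoint A x + cadjoint A y" for x y
    by (rule cinner_eqI) (simp add: adj cinner_add_right)
  have sc: "cadjoint A (c *\<^sub>C x) = c *\<^sub>C cadjoint A x" for c x
    by (rule cinner_eqI) (simp add: adj cinner_scaleC_right)
  have bd: "norm (cadjoint A y) \<le> norm y * K" for y
  proof -
    let ?z = "cadjoint A y"
    have "(norm ?z)\<^sup>2 = cmod (cinner (A ?z) y)"
      by (simp add: cinner_cadjoint[OF A] cinner_self norm_power)
    also have "\<dots> \<le> norm ?z * K * norm y"
      using cinner_cauchy_schwarz[of "A ?z" y] K[of ?z] by (meson mult_right_mono norm_ge_zero order_trans)
    finally have "norm ?z * norm ?z \<le> norm ?z * (norm y * K)" by (simp add: power2_eq_square mult_ac)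
    then show ?thesis using K0 by (cases "norm ?z = 0") (auto simp: mult_le_cancel_left)
  qed
  have "bounded_linear (cadjoint A)"
    by (rule bounded_linear_intro[OF add _ bd]) (metis sc scaleC_of_real)
  then show ?thesis using sc by (simp add: bounded_clinear_def)
qed

section \<open>Riemann--Stieltjes sums against a resolution of the identity\<close>

lemma norm_sum_sq_orthogonal:
  fixes v :: "'i \<Rightarrow> 'a::complex_hilbert_space"
  assumes "finite I" and "\<And>i j. i \<in> I \<Longrightarrow> j \<in> I \<Longrightarrow> i \<noteq> j \<Longrightarrow> cinner (v i) (v j) = 0"
  shows "(norm (\<Sum>i\<in>I. v i))\<^sup>2 = (\<Sum>i\<in>I. (norm (v i))\<^sup>2)"
  using assms
proof (induction I rule: finite_induct)
  case (insert i I)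
  have "cinner (v i) (\<Sum>j\<in>I. v j) = (\<Sum>j\<in>I. cinner (v i) (v j))"
    by (rule cinner.sum_right)
  also have "\<dots> = 0"
    using insert by (intro sum.neutral ballI insert.prems) auto
  finally show ?case
    using insert by (simp add: norm_add_sq)
qed simp

text \<open>Bounded coefficients are needed only where the vector does not vanish: below, the vectors are
  increments over intersections of cells, and nothing is known about the tags of disjoint cells.\<close>

lemma norm_sum_scaleR_orthogonal_le:
  fixes v :: "'i \<Rightarrow> 'a::complex_hilbert_space"
  assumes fin: "finite I" and orth: "\<And>i j. i \<in> I \<Longrightarrow> j \<in> I \<Longrightarrow> i \<noteq> j \<Longrightarrow> cinner (v i) (v j) = 0"
    and c: "\<And>i. i \<in> I \<Longrightarrow> v i \<noteq> 0 \<Longrightarrow> \<bar>c i\<bar> \<le> M" and M: "0 \<le> M"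
  shows "norm (\<Sum>i\<in>I. c i *\<^sub>R v i) \<le> M * norm (\<Sum>i\<in>I. v i)"
proof -
  have "(norm (\<Sum>i\<in>I. c i *\<^sub>R v i))\<^sup>2 = (\<Sum>i\<in>I. (norm (c i *\<^sub>R v i))\<^sup>2)"
    by (rule norm_sum_sq_orthogonal[OF fin]) (simp add: orth cinner_scaleR_left cinner_scaleR_right)
  also have "\<dots> \<le> (\<Sum>i\<in>I. M\<^sup>2 * (norm (v i))\<^sup>2)"
  proof (rule sum_mono)
    fix i assume "i \<in> I"
    then have "norm (c i *\<^sub>R v i) \<le> M * norm (v i)"
      using c[of i] by (cases "v i = 0") (auto intro: mult_right_mono)
    then show "(norm (c i *\<^sub>R v i))\<^sup>2 \<le> M\<^sup>2 * (norm (v i))\<^sup>2"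
      by (metis norm_ge_zero power_mono power_mult_distrib)
  qed
  also have "\<dots> = (M * norm (\<Sum>i\<in>I. v i))\<^sup>2"
    by (simp add: norm_sum_sq_orthogonal[OF fin orth] power_mult_distrib sum_distrib_left)
  finally show ?thesis
    by (rule power2_le_imp_le) (simp add: M)
qed

lemma eventually_rs_filter:
  "eventually P (rs_filter a b) \<longleftrightarrow>
     (\<exists>\<delta>>0. \<forall>p. p tagged_division_of {a..b} \<and> (\<lambda>x. ball x \<delta>) fine p \<longrightarrow> P p)"
proof -
  have "\<exists>x\<in>{0<..}. principal {p. p tagged_division_of {a..b} \<and> (\<lambda>t. ball t x) fine p}
      \<le> inf (principal {p. p tagged_division_of {a..b} \<and> (\<lambda>t. ball t d) fine p})
            (principal {p. p tagged_division_of {a..b} \<and> (\<lambda>t. ball t e) fine p})"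
    if "d \<in> {0<..}" "e \<in> {0<..}" for d e :: real
    using that by (intro bexI[of _ "min d e"]) (fastforce simp: fine_def)+
  then show ?thesis
    unfolding rs_filter_def by (subst eventually_INF_base) (auto simp: eventually_principal)
qed

lemma eventually_rs_filter_tagged_division:
  "eventually (\<lambda>p. p tagged_division_of {a..b}) (rs_filter a b)"
  unfolding eventually_rs_filter by (intro exI[of _ 1]) simp

lemma rs_filter_neq_bot [simp]: "rs_filter a b \<noteq> bot"
proof
  assume "rs_filter a b = bot"
  then have "eventually (\<lambda>_. False) (rs_filter a b)" by simp
  then obtain \<delta> :: real where "\<delta> > 0" "\<And>p. \<not> (p tagged_division_of {a..b} \<and> (\<lambda>x. ball x \<delta>) fine p)"
    unfolding eventually_rs_filter by blast
  moreover obtain p where "p tagged_division_of {a..b}" "(\<lambda>x. ball x \<delta>) fine p"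
    using fine_division_exists_real[OF gauge_ball[OF \<open>\<delta> > 0\<close>]] .
  ultimately show False by blast
qed

lemma tendsto_of_cauchy_net:
  fixes f :: "'i \<Rightarrow> 'a::banach"
  assumes "F \<noteq> bot"
    and "\<And>e. 0 < e \<Longrightarrow> \<exists>P. eventually P F \<and> (\<forall>x y. P x \<and> P y \<longrightarrow> dist (f x) (f y) < e)"
  shows "\<exists>l. (f \<longlongrightarrow> l) F"
proof -
  have "cauchy_filter (filtermap f F)"
    using assms(2) by (subst cauchy_filter_metric_filtermap) blast
  moreover have "complete (UNIV :: 'a set)" by (rule complete_UNIV)
  ultimately show ?thesis
    using assms(1) unfolding complete_uniform filterlim_def by (auto simp: filtermap_bot_iff)
qed

lemma tagged_division_of_cell:
  fixes a b :: real
  assumes "p tagged_division_of {a..b}" "(x, K) \<in> p"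
  obtains c d where "K = {c..d}" "c \<le> d" "a \<le> c" "d \<le> b" "c \<le> x" "x \<le> d"
proof -
  have "x \<in> K" "K \<subseteq> {a..b}" using tagged_division_ofD[OF assms(1)] assms(2) by auto
  moreover obtain c d where "K = {c..d}"
    using tagged_division_ofD(4)[OF assms] by auto
  ultimately show ?thesis using that[of c d] by auto
qed

lemma small_factor:
  fixes e N :: real
  assumes "0 < e" "0 \<le> N"
  shows "\<exists>\<omega>>0. \<omega> * N < e"
proof (intro exI[of _ "e / (N + 1)"] conjI)
  show "e / (N + 1) * N < e" using assms by (simp add: divide_less_eq)
qed (use assms in simp)

lemma oscillation_bound:
  fixes \<phi> :: "real \<Rightarrow> real"
  assumes "continuous_on {a..b} \<phi>" "0 < \<omega>"
  shows "\<exists>\<delta>>0. \<forall>x\<in>{a..b}. \<forall>y\<in>{a..b}. \<bar>x - y\<bar> < 2 * \<delta> \<longrightarrow> \<bar>\<phi> x - \<phi> y\<bar> \<le> \<omega>"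
proof -
  have "uniformly_continuous_on {a..b} \<phi>"
    using assms(1) by (intro compact_uniformly_continuous) auto
  then obtain d where d: "d > 0"
    "\<And>x y. x \<in> {a..b} \<Longrightarrow> y \<in> {a..b} \<Longrightarrow> dist y x < d \<Longrightarrow> dist (\<phi> y) (\<phi> x) < \<omega>"
    using assms(2) unfolding uniformly_continuous_on_def by metis
  show ?thesis
  proof (intro exI[of _ "d / 2"] conjI ballI impI)
    fix x y assume "x \<in> {a..b}" "y \<in> {a..b}" "\<bar>x - y\<bar> < 2 * (d / 2)"
    then show "\<bar>\<phi> x - \<phi> y\<bar> \<le> \<omega>" using d(2)[of y x] by (simp add: dist_real_def)
  qed (use d in simp)
qed

lemma at_bot_at_top_neq_bot [simp]: "(at_bot :: real filter) \<times>\<^sub>F (at_top :: real filter) \<noteq> bot"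
  by (simp add: prod_filter_eq_bot)

lemma eventually_interval_contains:
  "eventually (\<lambda>(a, b). a \<le> s \<and> t \<le> b) ((at_bot :: real filter) \<times>\<^sub>F (at_top :: real filter))"
  by (rule eventually_mono[OF eventually_prodI[OF eventually_le_at_bot[of s] eventually_ge_at_top[of t]]]) auto

text \<open>A resolution of the identity \<open>E\<close>, where \<open>E x\<close> is the projection belonging to \<open>(-\<infinity>, x]\<close>.  The
  increment over the closed interval from \<open>a\<close> to \<open>b\<close> is thus the projection belonging to \<open>(a, b]\<close>.\<close>

locale spectral_family =
  fixes E :: "real \<Rightarrow> 'h::complex_hilbert_space \<Rightarrow> 'h"
  assumes resolution: "resolution_of_identity E"
begin

lemma E_clinear: "bounded_clinear (E x)"
  and E_selfadjoint: "cinner (E x u) v = cinner u (E x v)"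
  and E_E: "E x (E y u) = E (min x y) u"
  and E_right_continuous: "((\<lambda>y. E y u) \<longlongrightarrow> E x u) (at_right x)"
  and E_at_bot: "((\<lambda>y. E y u) \<longlongrightarrow> 0) at_bot"
  and E_at_top: "((\<lambda>y. E y u) \<longlongrightarrow> u) at_top"
  using resolution unfolding resolution_of_identity_def by blast+

lemma increment_interval: "a \<le> b \<Longrightarrow> increment E {a..b} h = E b h - E a h"
  by (simp add: increment_def)

lemma bounded_linear_increment: "bounded_linear (increment E K)"
proof -
  have "bounded_linear (E x)" for x
    using E_clinear by (simp add: bounded_clinear_def)
  then have "bounded_linear (\<lambda>h. increment E K h)"
    unfolding increment_def by (cases "K = {}") (auto intro: bounded_linear_sub)
  then show ?thesis by simp
qed

lemmas increment_add = linear_add[OF bounded_linear.linear[OF bounded_linear_increment]]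
lemmas increment_diff = linear_diff[OF bounded_linear.linear[OF bounded_linear_increment]]
lemmas increment_scaleR = linear_scale[OF bounded_linear.linear[OF bounded_linear_increment]]
lemmas increment_sum = linear_sum[OF bounded_linear.linear[OF bounded_linear_increment]]
lemmas tendsto_increment = bounded_linear.tendsto[OF bounded_linear_increment]

lemma increment_scaleC: "increment E K (c *\<^sub>C h) = c *\<^sub>C increment E K h"
proof -
  have sc: "E x (c *\<^sub>C h) = c *\<^sub>C E x h" for x using E_clinear by (simp add: bounded_clinear_def)
  have "c *\<^sub>C (u - v) = c *\<^sub>C u - c *\<^sub>C v" for u v :: 'h
    by (rule linear_diff[OF bounded_linear.linear[OF bounded_linear_scaleC]])
  then show ?thesis
    using linear_0[OF bounded_linear.linear[OF bounded_linear_scaleC], of c]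
    by (cases "K = {}") (simp_all add: increment_def sc)
qed

lemma increment_zero [simp]: "increment E K 0 = 0"
  by (rule linear_0[OF bounded_linear.linear[OF bounded_linear_increment]])

lemma increment_selfadjoint: "cinner (increment E K u) v = cinner u (increment E K v)"
  by (simp add: increment_def cinner_diff_left cinner_diff_right E_selfadjoint)

lemma increment_increment:
  assumes "a \<le> b" "c \<le> d"
  shows "increment E {a..b} (increment E {c..d} h) = increment E ({a..b} \<inter> {c..d}) h"
proof -
  have lin: "E x (u - v) = E x u - E x v" for x u v
    using E_clinear[of x] linear_diff[OF bounded_linear.linear] by (auto simp: bounded_clinear_def)
  have "increment E {a..b} (increment E {c..d} h)
      = E (min b d) h - E (min b c) h - (E (min a d) h - E (min a c) h)"
    using assms by (simp add: increment_interval lin E_E)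
  also have "\<dots> = increment E {max a c..min b d} h"
    using assms by (auto simp: increment_def min_def max_def)
  finally show ?thesis by (simp add: Int_atLeastAtMost)
qed

lemma norm_increment_le:
  assumes "a \<le> b"
  shows "norm (increment E {a..b} h) \<le> norm h"
proof -
  let ?u = "increment E {a..b} h"
  \<comment> \<open>the increment is a self-adjoint idempotent\<close>
  have "(norm ?u)\<^sup>2 = Re (cinner h ?u)"
    using assms by (simp add: norm_sq_cinner increment_selfadjoint increment_increment)
  also have "\<dots> \<le> norm h * norm ?u"
    using complex_Re_le_cmod cinner_cauchy_schwarz order_trans by blast
  finally have "norm ?u * norm ?u \<le> norm h * norm ?u" by (simp add: power2_eq_square)
  then show ?thesis by (cases "norm ?u = 0") auto
qed

lemma increment_degenerate: "interior {c..d::real} = {} \<Longrightarrow> increment E {c..d} h = 0"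
  by (cases "c \<le> d") (auto simp: increment_def)

text \<open>Intervals that do not overlap have orthogonal increments.\<close>

lemma increment_orthogonal:
  assumes "a \<le> b" "c \<le> d" "interior {a..b} \<inter> interior {c..d} = {}"
  shows "cinner (increment E {a..b} u) (increment E {c..d} v) = 0"
proof -
  have "interior ({a..b} \<inter> {c..d}) = {}" using assms(3) by (simp add: interior_Int)
  then have "increment E ({a..b} \<inter> {c..d}) v = 0"
    using increment_degenerate[of "max a c" "min b d"] by (simp add: Int_atLeastAtMost)
  then show ?thesis
    using assms by (simp add: increment_selfadjoint increment_increment)
qed

lemma sum_increment:
  assumes "a \<le> b" "p tagged_division_of {a..b}"
  shows "(\<Sum>(x, K)\<in>p. increment E K h) = increment E {a..b} h"
proof -
  have "(\<Sum>(x, K)\<in>p. increment E K h) = (\<Sum>(x, K)\<in>p. E (Sup K) h - E (Inf K) h)"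
  proof (rule sum.cong)
    fix z assume "z \<in> p"
    then obtain x K where z: "z = (x, K)" "(x, K) \<in> p" by (cases z) auto
    obtain c d where "K = {c..d}" "c \<le> d" using tagged_division_of_cell[OF assms(2) z(2)] by blast
    then show "(case z of (x, K) \<Rightarrow> increment E K h) = (case z of (x, K) \<Rightarrow> E (Sup K) h - E (Inf K) h)"
      by (simp add: increment_def z)
  qed simp
  also have "\<dots> = increment E {a..b} h"
    using additive_tagged_division_1[OF assms, of "\<lambda>x. E x h"] assms by (simp add: increment_interval)
  finally show ?thesis .
qed

text \<open>The Riemann--Stieltjes sum of \<open>\<integral> dE\<^sub>x g(x)\<close> for a vector-valued integrand.\<close>

definition rsum :: "(real \<Rightarrow> 'h) \<Rightarrow> (real \<times> real set) set \<Rightarrow> 'h" where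
  "rsum g p = (\<Sum>(x, K)\<in>p. increment E K (g x))"

lemma rsum_const:
  assumes "a \<le> b" "p tagged_division_of {a..b}"
  shows "rsum (\<lambda>x. h) p = increment E {a..b} h"
  unfolding rsum_def by (rule sum_increment[OF assms])

lemma rsum_add: "rsum (\<lambda>x. g x + k x) p = rsum g p + rsum k p"
  by (simp add: rsum_def increment_add case_prod_beta sum.distrib)

lemma rsum_diff: "rsum (\<lambda>x. g x - k x) p = rsum g p - rsum k p"
  by (simp add: rsum_def increment_diff case_prod_beta sum_subtractf)

lemma rsum_scaleR: "rsum (\<lambda>x. c *\<^sub>R g x) p = c *\<^sub>R rsum g p"
  by (simp add: rsum_def increment_scaleR case_prod_beta scaleR_sum_right)

lemma rsum_scaleC: "rsum (\<lambda>x. c *\<^sub>C g x) p = c *\<^sub>C rsum g p"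
  by (simp add: rsum_def increment_scaleC case_prod_beta
      linear_sum[OF bounded_linear.linear[OF bounded_linear_scaleC]])

lemma cinner_rsum_rsum:
  assumes p: "p tagged_division_of {a..b}" and q: "q tagged_division_of {a..b}"
  shows "cinner (rsum g p) (rsum k q) =
    (\<Sum>(x, K)\<in>p. \<Sum>(y, L)\<in>q. cinner (increment E (K \<inter> L) (g x)) (k y))"
proof -
  have cell: "cinner (increment E K (g x)) (increment E L (k y)) = cinner (increment E (K \<inter> L) (g x)) (k y)"
    if K: "(x, K) \<in> p" and L: "(y, L) \<in> q" for x K y L
  proof -
    obtain c d where c: "K = {c..d}" "c \<le> d" using tagged_division_of_cell[OF p K] by metis
    obtain c' d' where c': "L = {c'..d'}" "c' \<le> d'" using tagged_division_of_cell[OF q L] by metis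
    show ?thesis
      by (subst increment_selfadjoint[symmetric]) (simp add: c c' increment_increment Int_commute)
  qed
  have "cinner (rsum g p) (rsum k q) =
      (\<Sum>z\<in>p. \<Sum>w\<in>q. cinner (increment E (snd z) (g (fst z))) (increment E (snd w) (k (fst w))))"
    unfolding rsum_def case_prod_beta by (subst cinner.sum_left, subst cinner.sum_right) (rule refl)
  also have "\<dots> = (\<Sum>z\<in>p. \<Sum>w\<in>q. cinner (increment E (snd z \<inter> snd w) (g (fst z))) (k (fst w)))"
    by (intro sum.cong refl cell) simp_all
  finally show ?thesis by (simp add: case_prod_beta)
qed

lemma rsum_cells_orthogonal:
  assumes p: "p tagged_division_of {a..b}" and z: "z \<in> p" "w \<in> p" "z \<noteq> w"
  shows "cinner (increment E (snd z) u) (increment E (snd w) v) = 0"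
proof -
  obtain x K y L where zw: "z = (x, K)" "w = (y, L)" by (metis prod.exhaust)
  obtain c d where c: "K = {c..d}" "c \<le> d" using tagged_division_of_cell[OF p, of x K] z zw by metis
  obtain c' d' where c': "L = {c'..d'}" "c' \<le> d'" using tagged_division_of_cell[OF p, of y L] z zw by metis
  have "interior K \<inter> interior L = {}"
    using tagged_division_ofD(5)[OF p, of x K y L] z zw by auto
  then show ?thesis using increment_orthogonal c c' zw by simp
qed

text \<open>The increments over the cells of one partition are orthogonal, so that a bounded scalar factor
  costs no more than its bound.\<close>

lemma norm_rsum_scaleR_le:
  assumes p: "p tagged_division_of {a..b}"
    and M: "0 \<le> M" "\<And>x. a \<le> x \<Longrightarrow> x \<le> b \<Longrightarrow> \<bar>\<phi> x\<bar> \<le> M"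
  shows "norm (rsum (\<lambda>x. \<phi> x *\<^sub>R g x) p) \<le> M * norm (rsum g p)"
proof -
  have "norm (\<Sum>z\<in>p. \<phi> (fst z) *\<^sub>R increment E (snd z) (g (fst z)))
     \<le> M * norm (\<Sum>z\<in>p. increment E (snd z) (g (fst z)))"
  proof (rule norm_sum_scaleR_orthogonal_le)
    show "finite p" using tagged_division_ofD(1)[OF p] .
    show "\<bar>\<phi> (fst z)\<bar> \<le> M" if "z \<in> p" for z
      by (rule tagged_division_of_cell[OF p, of "fst z" "snd z"]) (use that in \<open>auto intro: M(2)\<close>)
  qed (auto simp: rsum_cells_orthogonal[OF p] M(1))
  then show ?thesis by (simp add: rsum_def case_prod_beta increment_scaleR)
qed

text \<open>On the common refinement of two fine partitions \<open>p\<close> and \<open>r\<close> the tags of two overlapping cells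
  are close, and the increments over the cells are orthogonal.  Hence multiplying the integrand by
  \<open>\<phi>\<close> is, up to the oscillation of \<open>\<phi>\<close>, the same as applying a Riemann sum of \<open>\<integral> \<phi> dE\<close>.\<close>

lemma rsum_scaleR_approx:
  assumes ab: "a \<le> b"
    and p: "p tagged_division_of {a..b}" "(\<lambda>x. ball x \<delta>) fine p"
    and r: "r tagged_division_of {a..b}" "(\<lambda>x. ball x \<delta>) fine r"
    and \<omega>: "0 \<le> \<omega>"
      "\<And>x y. x \<in> {a..b} \<Longrightarrow> y \<in> {a..b} \<Longrightarrow> \<bar>x - y\<bar> < 2 * \<delta> \<Longrightarrow> \<bar>\<phi> x - \<phi> y\<bar> \<le> \<omega>"
  shows "norm (rsum (\<lambda>x. \<phi> x *\<^sub>R g x) p - rsum (\<lambda>y. \<phi> y *\<^sub>R rsum g p) r) \<le> \<omega> * norm (rsum g p)"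
proof -
  \<comment> \<open>the part of the sum over \<open>p\<close> that belongs to the cell of \<open>z\<close> and the cell of \<open>w\<close>\<close>
  define v :: "(real \<times> real set) \<times> (real \<times> real set) \<Rightarrow> 'h"
    where "v = (\<lambda>(z, w). increment E (snd z) (increment E (snd w) (g (fst z))))"
  have cell: "\<exists>c d. snd z = {c..d} \<and> c \<le> d \<and> a \<le> c \<and> d \<le> b \<and> fst z \<in> snd z"
    if z: "z \<in> p \<or> z \<in> r" for z
  proof -
    obtain q where q: "q tagged_division_of {a..b}" "(fst z, snd z) \<in> q"
      using z p(1) r(1) by auto
    show ?thesis by (rule tagged_division_of_cell[OF q]) auto
  qed
  have comm: "increment E (snd w) (increment E (snd z) u) = increment E (snd z) (increment E (snd w) u)"
    if z: "z \<in> p" and w: "w \<in> r" for z w u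
  proof -
    obtain c d where cd: "snd z = {c..d}" "c \<le> d" using cell[of z] z by blast
    obtain c' d' where cd': "snd w = {c'..d'}" "c' \<le> d'" using cell[of w] w by blast
    show ?thesis unfolding cd cd' by (simp only: increment_increment cd(2) cd'(2) Int_commute)
  qed
  have split: "(\<Sum>w\<in>r. v (z, w)) = increment E (snd z) (g (fst z))" if z: "z \<in> p" for z
  proof -
    obtain c d where cd: "snd z = {c..d}" "c \<le> d" "a \<le> c" "d \<le> b" using cell[of z] z by blast
    have "(\<Sum>w\<in>r. v (z, w)) = increment E (snd z) (increment E {a..b} (g (fst z)))"
      using sum_increment[OF ab r(1)] by (simp add: v_def case_prod_beta increment_sum[symmetric])
    also have "\<dots> = increment E ({c..d} \<inter> {a..b}) (g (fst z))"
      using cd ab by (simp add: increment_increment)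
    also have "{c..d} \<inter> {a..b} = snd z" using cd by auto
    finally show ?thesis .
  qed
  have 1: "rsum g p = (\<Sum>i\<in>p \<times> r. v i)"
  proof -
    have "(\<Sum>i\<in>p \<times> r. v i) = (\<Sum>z\<in>p. \<Sum>w\<in>r. v (z, w))"
      by (simp add: sum.cartesian_product)
    also have "\<dots> = rsum g p"
      by (simp add: rsum_def case_prod_beta split)
    finally show ?thesis by simp
  qed
  have 2: "rsum (\<lambda>x. \<phi> x *\<^sub>R g x) p = (\<Sum>i\<in>p \<times> r. \<phi> (fst (fst i)) *\<^sub>R v i)"
  proof -
    have "(\<Sum>i\<in>p \<times> r. \<phi> (fst (fst i)) *\<^sub>R v i) = (\<Sum>z\<in>p. \<Sum>w\<in>r. \<phi> (fst z) *\<^sub>R v (z, w))"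
      by (simp add: sum.cartesian_product case_prod_beta)
    also have "\<dots> = rsum (\<lambda>x. \<phi> x *\<^sub>R g x) p"
      by (simp add: rsum_def case_prod_beta split scaleR_sum_right[symmetric] increment_scaleR)
    finally show ?thesis by simp
  qed
  have 3: "rsum (\<lambda>y. \<phi> y *\<^sub>R rsum g p) r = (\<Sum>i\<in>p \<times> r. \<phi> (fst (snd i)) *\<^sub>R v i)"
  proof -
    have "(\<Sum>i\<in>p \<times> r. \<phi> (fst (snd i)) *\<^sub>R v i) = (\<Sum>z\<in>p. \<Sum>w\<in>r. \<phi> (fst w) *\<^sub>R v (z, w))"
      by (simp add: sum.cartesian_product case_prod_beta)
    also have "\<dots> = (\<Sum>w\<in>r. \<Sum>z\<in>p. \<phi> (fst w) *\<^sub>R v (z, w))" by (rule sum.swap)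
    also have "\<dots> = (\<Sum>w\<in>r. \<Sum>z\<in>p. \<phi> (fst w) *\<^sub>R increment E (snd w) (increment E (snd z) (g (fst z))))"
      by (intro sum.cong refl) (simp add: v_def comm[symmetric])
    also have "\<dots> = (\<Sum>w\<in>r. \<phi> (fst w) *\<^sub>R increment E (snd w) (\<Sum>z\<in>p. increment E (snd z) (g (fst z))))"
      by (simp add: increment_sum scaleR_sum_right)
    also have "\<dots> = rsum (\<lambda>y. \<phi> y *\<^sub>R rsum g p) r"
      by (simp add: rsum_def case_prod_beta increment_scaleR)
    finally show ?thesis by simp
  qed
  have "norm (\<Sum>i\<in>p \<times> r. (\<phi> (fst (fst i)) - \<phi> (fst (snd i))) *\<^sub>R v i) \<le> \<omega> * norm (\<Sum>i\<in>p \<times> r. v i)"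
  proof (rule norm_sum_scaleR_orthogonal_le)
    show "finite (p \<times> r)" using tagged_division_ofD(1)[OF p(1)] tagged_division_ofD(1)[OF r(1)] by simp
    show "cinner (v i) (v j) = 0" if ij: "i \<in> p \<times> r" "j \<in> p \<times> r" "i \<noteq> j" for i j
    proof -
      obtain z w z' w' where zw: "i = (z, w)" "j = (z', w')" by (metis prod.exhaust)
      then have m: "z \<in> p" "w \<in> r" "z' \<in> p" "w' \<in> r" using ij by auto
      consider "z \<noteq> z'" | "w \<noteq> w'" using ij zw by auto
      then show ?thesis
      proof cases
        case 1
        then show ?thesis using m by (simp add: v_def zw rsum_cells_orthogonal[OF p(1)])
      next
        case 2
        have "cinner (v i) (v j) = cinner (increment E (snd w) (increment E (snd z) (g (fst z))))
             (increment E (snd w') (increment E (snd z') (g (fst z'))))"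
          by (simp add: v_def zw comm[OF m(1,2)] comm[OF m(3,4)])
        then show ?thesis using 2 m by (simp add: rsum_cells_orthogonal[OF r(1)])
      qed
    qed
    show "\<bar>\<phi> (fst (fst i)) - \<phi> (fst (snd i))\<bar> \<le> \<omega>" if i: "i \<in> p \<times> r" "v i \<noteq> 0" for i
    proof -
      obtain z w where zw: "i = (z, w)" "z \<in> p" "w \<in> r" using i by auto
      obtain c d where c: "snd z = {c..d}" "c \<le> d" "fst z \<in> snd z" "a \<le> c" "d \<le> b"
        using cell[of z] zw by blast
      obtain c' d' where c': "snd w = {c'..d'}" "c' \<le> d'" "fst w \<in> snd w" "a \<le> c'" "d' \<le> b"
        using cell[of w] zw by blast
      have "v i = increment E (snd z \<inter> snd w) (g (fst z))"
        using c c' by (simp add: zw v_def increment_increment)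
      \<comment> \<open>cells with a common point have tags at a distance less than \<open>2 \<delta>\<close>\<close>
      then have "snd z \<inter> snd w \<noteq> {}" using i(2) by (auto simp: increment_def)
      then obtain t where t: "t \<in> snd z" "t \<in> snd w" by blast
      have "snd z \<subseteq> ball (fst z) \<delta>" "snd w \<subseteq> ball (fst w) \<delta>"
        using fineD[OF p(2), of "fst z" "snd z"] fineD[OF r(2), of "fst w" "snd w"] zw by auto
      then have "dist (fst z) t < \<delta>" "dist (fst w) t < \<delta>" using t by auto
      then have "\<bar>fst z - fst w\<bar> < 2 * \<delta>" by (auto simp: dist_real_def)
      then show ?thesis using c c' zw \<omega>(2)[of "fst z" "fst w"] by auto
    qed
  qed (rule \<omega>(1))
  then show ?thesis
    unfolding 2 3 unfolding 1 by (simp add: sum_subtractf scaleR_diff_left)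
qed

section \<open>Scalar integrals\<close>

lemma rsum_increment_const:
  assumes ab: "a \<le> b" and p: "p tagged_division_of {a..b}"
  shows "rsum (\<lambda>x. \<phi> x *\<^sub>R increment E {a..b} h) p = rsum (\<lambda>x. \<phi> x *\<^sub>R h) p"
proof -
  have "increment E K (increment E {a..b} h) = increment E K h" if K: "(x, K) \<in> p" for x K
  proof -
    obtain c d where "K = {c..d}" "c \<le> d" "a \<le> c" "d \<le> b"
      using tagged_division_of_cell[OF p K] by blast
    then show ?thesis using ab by (simp add: increment_increment)
  qed
  then show ?thesis
    unfolding rsum_def by (intro sum.cong) (auto simp: increment_scaleR)
qed

text \<open>The operator \<open>\<integral> \<phi>(x) dE\<^sub>x\<close> over \<open>(a, b]\<close>, for a real function \<open>\<phi>\<close>.  It is meaningful if the limit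
  exists, for instance for \<open>\<phi>\<close> continuous on the closed interval.\<close>

definition mult_op :: "(real \<Rightarrow> real) \<Rightarrow> real \<Rightarrow> real \<Rightarrow> 'h \<Rightarrow> 'h" where
  "mult_op \<phi> a b h = Lim (rs_filter a b) (rsum (\<lambda>x. \<phi> x *\<^sub>R h))"

text \<open>The limit in the definition exists: for a constant integrand the comparison
  \<open>rsum_scaleR_approx\<close> is between the sums over two partitions.\<close>

lemma tendsto_mult_const:
  assumes ab: "a \<le> b" and \<phi>: "continuous_on {a..b} \<phi>"
  shows "(rsum (\<lambda>x. \<phi> x *\<^sub>R h) \<longlongrightarrow> mult_op \<phi> a b h) (rs_filter a b)"
proof -
  have "\<exists>u. (rsum (\<lambda>x. \<phi> x *\<^sub>R h) \<longlongrightarrow> u) (rs_filter a b)"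
  proof (rule tendsto_of_cauchy_net)
    fix e :: real assume e: "e > 0"
    obtain \<omega> where \<omega>: "\<omega> > 0" and lt: "\<omega> * norm h < e"
      using small_factor[OF e norm_ge_zero] by blast
    obtain \<delta> where \<delta>: "\<delta> > 0"
      "\<And>x y. x \<in> {a..b} \<Longrightarrow> y \<in> {a..b} \<Longrightarrow> \<bar>x - y\<bar> < 2 * \<delta> \<Longrightarrow> \<bar>\<phi> x - \<phi> y\<bar> \<le> \<omega>"
      using oscillation_bound[OF \<phi> \<omega>] by blast
    let ?P = "\<lambda>p. p tagged_division_of {a..b} \<and> (\<lambda>x. ball x \<delta>) fine p"
    have "dist (rsum (\<lambda>x. \<phi> x *\<^sub>R h) p) (rsum (\<lambda>x. \<phi> x *\<^sub>R h) r) < e" if "?P p" "?P r" for p r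
    proof -
      have "norm (rsum (\<lambda>x. \<phi> x *\<^sub>R h) p - rsum (\<lambda>y. \<phi> y *\<^sub>R rsum (\<lambda>x. h) p) r) \<le> \<omega> * norm (rsum (\<lambda>x. h) p)"
        using that \<omega> by (intro rsum_scaleR_approx[OF ab] \<delta>(2)) auto
      also have "\<dots> \<le> \<omega> * norm h"
        using that \<omega> ab by (simp add: rsum_const norm_increment_le)
      finally show ?thesis
        using that ab lt by (simp add: rsum_const rsum_increment_const dist_norm)
    qed
    moreover have "eventually ?P (rs_filter a b)"
      unfolding eventually_rs_filter using \<delta>(1) by blast
    ultimately show "\<exists>P. eventually P (rs_filter a b) \<and>
        (\<forall>p r. P p \<and> P r \<longrightarrow> dist (rsum (\<lambda>x. \<phi> x *\<^sub>R h) p) (rsum (\<lambda>x. \<phi> x *\<^sub>R h) r) < e)"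
      by (intro exI[of _ ?P]) blast
  qed simp
  then show ?thesis
    unfolding mult_op_def using tendsto_Lim[OF rs_filter_neq_bot] by metis
qed

lemma norm_mult_le:
  assumes ab: "a \<le> b" and \<phi>: "continuous_on {a..b} \<phi>"
    and M: "0 \<le> M" "\<And>x. a \<le> x \<Longrightarrow> x \<le> b \<Longrightarrow> \<bar>\<phi> x\<bar> \<le> M"
  shows "norm (mult_op \<phi> a b h) \<le> M * norm h"
proof -
  have "eventually (\<lambda>p. norm (rsum (\<lambda>x. \<phi> x *\<^sub>R h) p) \<le> M * norm h) (rs_filter a b)"
    using eventually_rs_filter_tagged_division
  proof eventually_elim
    case (elim p)
    have "norm (rsum (\<lambda>x. \<phi> x *\<^sub>R h) p) \<le> M * norm (rsum (\<lambda>x. h) p)"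
      by (rule norm_rsum_scaleR_le[OF elim M])
    also have "\<dots> \<le> M * norm h"
      using M(1) by (simp add: rsum_const[OF ab elim] norm_increment_le[OF ab] mult_left_mono)
    finally show ?case .
  qed
  then show ?thesis
    using tendsto_upperbound[OF tendsto_norm[OF tendsto_mult_const[OF ab \<phi>]]] rs_filter_neq_bot by blast
qed

lemma bounded_linear_mult:
  assumes ab: "a \<le> b" and \<phi>: "continuous_on {a..b} \<phi>"
  shows "bounded_linear (mult_op \<phi> a b)"
proof -
  note lim = tendsto_mult_const[OF ab \<phi>]
  note uniq = tendsto_unique[OF rs_filter_neq_bot]
  have "compact (\<phi> ` {a..b})" using \<phi> by (intro compact_continuous_image) auto
  then have "bounded (\<phi> ` {a..b})" by (rule compact_imp_bounded)
  then obtain M where "\<forall>y\<in>\<phi> ` {a..b}. \<bar>y\<bar> \<le> M" unfolding bounded_real by blast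
  then have M: "\<And>x. x \<in> {a..b} \<Longrightarrow> \<bar>\<phi> x\<bar> \<le> M" by blast
  have M0: "0 \<le> M" using M[of a] ab by auto
  show ?thesis
  proof (rule bounded_linear_intro)
    fix h k :: 'h and r :: real
    show "mult_op \<phi> a b (h + k) = mult_op \<phi> a b h + mult_op \<phi> a b k"
      using uniq[OF lim[of "h + k"]] tendsto_add[OF lim[of h] lim[of k]]
      by (simp add: rsum_add[symmetric] scaleR_add_right)
    show "mult_op \<phi> a b (r *\<^sub>R h) = r *\<^sub>R mult_op \<phi> a b h"
      using uniq[OF lim[of "r *\<^sub>R h"]] tendsto_scaleR[OF tendsto_const lim[of h], of r]
      by (simp add: rsum_scaleR[symmetric] mult.commute)
    show "norm (mult_op \<phi> a b h) \<le> norm h * M"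
      using norm_mult_le[OF ab \<phi> M0] M by (simp add: mult.commute)
  qed
qed

lemma mult_increment:
  assumes ab: "a \<le> b" and \<phi>: "continuous_on {a..b} \<phi>"
  shows "mult_op \<phi> a b (increment E {a..b} h) = mult_op \<phi> a b h"
proof (rule tendsto_unique[OF rs_filter_neq_bot tendsto_mult_const[OF ab \<phi>]])
  have "eventually (\<lambda>p. rsum (\<lambda>x. \<phi> x *\<^sub>R h) p = rsum (\<lambda>x. \<phi> x *\<^sub>R increment E {a..b} h) p) (rs_filter a b)"
    using eventually_rs_filter_tagged_division by eventually_elim (simp add: rsum_increment_const[OF ab])
  then show "(rsum (\<lambda>x. \<phi> x *\<^sub>R increment E {a..b} h) \<longlongrightarrow> mult_op \<phi> a b h) (rs_filter a b)"
    using tendsto_mult_const[OF ab \<phi>, of h] by (rule Lim_transform_eventually[rotated])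
qed

text \<open>If the vector integral of \<open>g\<close> exists then so does that of \<open>\<phi> g\<close>, for scalar \<open>\<phi>\<close>.  This is not
  a matter of continuity of \<open>g\<close>, which does not suffice for existence in infinite dimension.\<close>

lemma tendsto_rsum_scaleR:
  assumes ab: "a \<le> b" and \<phi>: "continuous_on {a..b} \<phi>"
    and g: "(rsum g \<longlongrightarrow> u) (rs_filter a b)"
  shows "(rsum (\<lambda>x. \<phi> x *\<^sub>R g x) \<longlongrightarrow> mult_op \<phi> a b u) (rs_filter a b)"
proof -
  let ?S = "rsum (\<lambda>x. \<phi> x *\<^sub>R g x)"
  \<comment> \<open>for fixed \<open>p\<close>, the limit over \<open>r\<close> in \<open>rsum_scaleR_approx\<close>; the sums over \<open>p\<close> are eventually
    bounded because they converge\<close>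
  have "((\<lambda>p. ?S p - mult_op \<phi> a b (rsum g p)) \<longlongrightarrow> 0) (rs_filter a b)"
  proof (rule tendstoI)
    fix e :: real assume e: "e > 0"
    obtain \<omega> where \<omega>: "\<omega> > 0" and lt: "\<omega> * (norm u + 1) < e"
      using small_factor[OF e, of "norm u + 1"] by auto
    obtain \<delta> where \<delta>: "\<delta> > 0"
      "\<And>x y. x \<in> {a..b} \<Longrightarrow> y \<in> {a..b} \<Longrightarrow> \<bar>x - y\<bar> < 2 * \<delta> \<Longrightarrow> \<bar>\<phi> x - \<phi> y\<bar> \<le> \<omega>"
      using oscillation_bound[OF \<phi> \<omega>] by blast
    let ?P = "\<lambda>p. p tagged_division_of {a..b} \<and> (\<lambda>x. ball x \<delta>) fine p"
    have P: "eventually ?P (rs_filter a b)"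
      unfolding eventually_rs_filter using \<delta>(1) by blast
    have bd: "eventually (\<lambda>p. norm (rsum g p) < norm u + 1) (rs_filter a b)"
      by (rule order_tendstoD[OF tendsto_norm[OF g]]) simp
    have approx: "norm (?S p - mult_op \<phi> a b (rsum g p)) \<le> \<omega> * norm (rsum g p)" if "?P p" for p
    proof (rule tendsto_upperbound)
      show "((\<lambda>r. norm (?S p - rsum (\<lambda>y. \<phi> y *\<^sub>R rsum g p) r)) \<longlongrightarrow>
          norm (?S p - mult_op \<phi> a b (rsum g p))) (rs_filter a b)"
        by (intro tendsto_norm tendsto_diff tendsto_const tendsto_mult_const[OF ab \<phi>])
      show "eventually (\<lambda>r. norm (?S p - rsum (\<lambda>y. \<phi> y *\<^sub>R rsum g p) r) \<le> \<omega> * norm (rsum g p)) (rs_filter a b)"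
        using P
      proof eventually_elim
        case (elim r)
        then show ?case using that \<omega> by (intro rsum_scaleR_approx[OF ab] \<delta>(2)) auto
      qed
    qed simp
    show "eventually (\<lambda>p. dist (?S p - mult_op \<phi> a b (rsum g p)) 0 < e) (rs_filter a b)"
      using P bd
    proof eventually_elim
      case (elim p)
      have "norm (?S p - mult_op \<phi> a b (rsum g p)) \<le> \<omega> * (norm u + 1)"
        using approx[OF elim(1)] mult_left_mono[of "norm (rsum g p)" "norm u + 1" \<omega>] elim(2) \<omega> by linarith
      also have "\<dots> < e" by (rule lt)
      finally show ?case by simp
    qed
  qed
  moreover have "((\<lambda>p. mult_op \<phi> a b (rsum g p)) \<longlongrightarrow> mult_op \<phi> a b u) (rs_filter a b)"
    by (rule bounded_linear.tendsto[OF bounded_linear_mult[OF ab \<phi>] g])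
  ultimately have "((\<lambda>p. (?S p - mult_op \<phi> a b (rsum g p)) + mult_op \<phi> a b (rsum g p)) \<longlongrightarrow> 0 + mult_op \<phi> a b u) (rs_filter a b)"
    by (rule tendsto_add)
  then show ?thesis by simp
qed

section \<open>Integrals over the line\<close>

text \<open>Integrals restrict to subintervals.  The proof evaluates the large integral on partitions that
  have \<open>a\<close> and \<open>b\<close> as division points: for a cell with \<open>a\<close> in its interior the tag might lie outside
  of the smaller interval.\<close>

lemma increment_integral_restrict:
  assumes le: "a' \<le> a" "a < b" "b \<le> b'"
    and u': "(rsum g \<longlongrightarrow> u') (rs_filter a' b')" and u: "(rsum g \<longlongrightarrow> u) (rs_filter a b)"
  shows "increment E {a..b} u' = u"
proof (rule ccontr)
  assume ne: "increment E {a..b} u' \<noteq> u"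
  define e where "e = dist (increment E {a..b} u') u / 2"
  have e: "e > 0" using ne by (simp add: e_def)
  have "eventually (\<lambda>p. dist (increment E {a..b} (rsum g p)) (increment E {a..b} u') < e) (rs_filter a' b')"
    by (rule tendstoD[OF tendsto_increment[OF u'] e])
  then obtain d' where d': "d' > 0" "\<And>p. p tagged_division_of {a'..b'} \<Longrightarrow> (\<lambda>x. ball x d') fine p \<Longrightarrow>
      dist (increment E {a..b} (rsum g p)) (increment E {a..b} u') < e"
    unfolding eventually_rs_filter by blast
  obtain d where d: "d > 0" "\<And>p. p tagged_division_of {a..b} \<Longrightarrow> (\<lambda>x. ball x d) fine p \<Longrightarrow>
      dist (rsum g p) u < e"
    using tendstoD[OF u e] unfolding eventually_rs_filter by blast
  define \<gamma> where "\<gamma> = (\<lambda>x::real. ball x (min d d'))"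
  have \<gamma>: "gauge \<gamma>" unfolding \<gamma>_def by (rule gauge_ball) (use d d' in simp)
  obtain p0 where p0: "p0 tagged_division_of {a'..a}" "\<gamma> fine p0" using fine_division_exists_real[OF \<gamma>] .
  obtain p1 where p1: "p1 tagged_division_of {a..b}" "\<gamma> fine p1" using fine_division_exists_real[OF \<gamma>] .
  obtain p2 where p2: "p2 tagged_division_of {b..b'}" "\<gamma> fine p2" using fine_division_exists_real[OF \<gamma>] .
  let ?p = "(p0 \<union> p1) \<union> p2"
  have un: "{a'..a} \<union> {a..b} = {a'..b}" "{a'..b} \<union> {b..b'} = {a'..b'}" using le by auto
  have "p0 \<union> p1 tagged_division_of {a'..a} \<union> {a..b}"
    by (rule tagged_division_Un[OF p0(1) p1(1)]) auto
  then have p01: "p0 \<union> p1 tagged_division_of {a'..b}" by (simp add: un)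
  have "?p tagged_division_of {a'..b} \<union> {b..b'}"
    by (rule tagged_division_Un[OF p01 p2(1)]) auto
  then have p: "?p tagged_division_of {a'..b'}" by (simp add: un)
  have fine: "\<gamma> fine ?p" by (intro fine_Un p0 p1 p2)
  have inc0: "increment E {a..b} (increment E K h) = 0" if "(x, K) \<in> p0 \<union> p2" for x K h
  proof -
    obtain s t where st: "K = {s..t}" "s \<le> t" "t \<le> a \<or> b \<le> s"
    proof (cases "(x, K) \<in> p0")
      case True
      from tagged_division_of_cell[OF p0(1) this] that show ?thesis by metis
    next
      case False
      then have "(x, K) \<in> p2" using \<open>(x, K) \<in> p0 \<union> p2\<close> by blast
      from tagged_division_of_cell[OF p2(1) this] that show ?thesis by metis
    qed
    have "interior ({a..b} \<inter> {s..t}) = {}" using st le by (auto simp: interior_Int)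
    then have "increment E ({a..b} \<inter> {s..t}) h = 0"
      using increment_degenerate[of "max a s" "min b t"] by (simp add: Int_atLeastAtMost)
    then show ?thesis using st le by (simp add: increment_increment)
  qed
  have inc1: "increment E {a..b} (increment E K h) = increment E K h" if K: "(x, K) \<in> p1" for x K h
  proof -
    obtain s t where st: "K = {s..t}" "s \<le> t" "a \<le> s" "t \<le> b"
      using tagged_division_of_cell[OF p1(1) K] by metis
    then show ?thesis using le by (simp add: increment_increment Int_absorb1)
  qed
  have "increment E {a..b} (rsum g ?p) = (\<Sum>(x, K)\<in>?p. increment E {a..b} (increment E K (g x)))"
    by (simp add: rsum_def increment_sum case_prod_beta)
  also have "\<dots> = (\<Sum>(x, K)\<in>p1. increment E {a..b} (increment E K (g x)))"
    by (rule sum.mono_neutral_right) (use tagged_division_ofD(1)[OF p] inc0 in auto)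
  also have "\<dots> = rsum g p1"
    unfolding rsum_def by (rule sum.cong) (auto simp: inc1)
  finally have eq: "increment E {a..b} (rsum g ?p) = rsum g p1" .
  have "\<gamma> x \<subseteq> ball x d'" "\<gamma> x \<subseteq> ball x d" for x by (auto simp: \<gamma>_def)
  then have "(\<lambda>x. ball x d') fine ?p" "(\<lambda>x. ball x d) fine p1"
    using fine p1(2) unfolding fine_def by (blast, blast)
  then have "dist (rsum g p1) (increment E {a..b} u') < e" "dist (rsum g p1) u < e"
    using d'(2)[OF p] d(2)[OF p1(1)] eq by auto
  then have "dist (increment E {a..b} u') u < e + e"
    using dist_triangle_less_add[of "increment E {a..b} u'" "rsum g p1" e u e] by (simp add: dist_commute)
  then show False by (simp add: e_def)
qed

lemma tendsto_increment_UNIV: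
  "((\<lambda>(a, b). increment E {a..b} h) \<longlongrightarrow> h) (at_bot \<times>\<^sub>F at_top)"
proof -
  have "((\<lambda>z. E (snd z) h - E (fst z) h) \<longlongrightarrow> h - 0) (at_bot \<times>\<^sub>F at_top)"
    by (intro tendsto_diff filterlim_compose[OF E_at_top filterlim_snd] filterlim_compose[OF E_at_bot filterlim_fst])
  moreover have "eventually (\<lambda>z. E (snd z) h - E (fst z) h = (case z of (a, b) \<Rightarrow> increment E {a..b} h)) (at_bot \<times>\<^sub>F at_top)"
    using eventually_interval_contains[of 0 0] by eventually_elim (auto simp: increment_def)
  ultimately show ?thesis by (simp add: Lim_transform_eventually)
qed

lemma increment_eqI:
  assumes "\<And>a b. a < b \<Longrightarrow> increment E {a..b} h = increment E {a..b} k"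
  shows "h = k"
proof (rule tendsto_unique[OF at_bot_at_top_neq_bot tendsto_increment_UNIV])
  have "increment E {a..b} k = increment E {a..b} h" for a b
    using assms[of a b] by (cases "a < b") (auto simp: increment_def)
  then show "((\<lambda>(a, b). increment E {a..b} h) \<longlongrightarrow> k) (at_bot \<times>\<^sub>F at_top)"
    using tendsto_increment_UNIV[of k] by simp
qed

text \<open>The improper integral is \<open>y\<close> if and only if over each bounded interval the integral is the
  increment of \<open>y\<close>; convergence at infinity then follows.\<close>

lemma has_rs_integral_iff:
  "has_rs_integral (\<lambda>x K. increment E K (g x)) y \<longleftrightarrow>
     (\<forall>a b. a < b \<longrightarrow> (rsum g \<longlongrightarrow> increment E {a..b} y) (rs_filter a b))"
proof
  assume "has_rs_integral (\<lambda>x K. increment E K (g x)) y"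
  then obtain J where J: "\<And>a b. a < b \<Longrightarrow> (rsum g \<longlongrightarrow> J a b) (rs_filter a b)"
    and lim: "((\<lambda>(a, b). J a b) \<longlongrightarrow> y) (at_bot \<times>\<^sub>F at_top)"
    unfolding has_rs_integral_def rsum_def by blast
  have "increment E {a..b} y = J a b" if ab: "a < b" for a b
  proof (rule tendsto_unique[OF at_bot_at_top_neq_bot])
    show "((\<lambda>z. increment E {a..b} (case z of (a, b) \<Rightarrow> J a b)) \<longlongrightarrow> increment E {a..b} y) (at_bot \<times>\<^sub>F at_top)"
      by (rule tendsto_increment[OF lim])
    have "eventually (\<lambda>z. increment E {a..b} (case z of (a, b) \<Rightarrow> J a b) = J a b) (at_bot \<times>\<^sub>F at_top)"
      using eventually_interval_contains[of a b]
    proof eventually_elim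
      case (elim z)
      then show ?case
        using ab increment_integral_restrict[OF _ ab _ J J[OF ab], of "fst z" "snd z"] by (auto simp: case_prod_beta)
    qed
    then show "((\<lambda>z. increment E {a..b} (case z of (a, b) \<Rightarrow> J a b)) \<longlongrightarrow> J a b) (at_bot \<times>\<^sub>F at_top)"
      by (simp add: tendsto_eventually)
  qed
  then show "\<forall>a b. a < b \<longrightarrow> (rsum g \<longlongrightarrow> increment E {a..b} y) (rs_filter a b)"
    using J by simp
next
  assume "\<forall>a b. a < b \<longrightarrow> (rsum g \<longlongrightarrow> increment E {a..b} y) (rs_filter a b)"
  then show "has_rs_integral (\<lambda>x K. increment E K (g x)) y"
    unfolding has_rs_integral_def rsum_def
    by (intro exI[of _ "\<lambda>a b. increment E {a..b} y"]) (simp add: tendsto_increment_UNIV)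
qed

lemma has_rs_integral_unique:
  assumes "has_rs_integral (\<lambda>x K. increment E K (g x)) y" "has_rs_integral (\<lambda>x K. increment E K (g x)) z"
  shows "y = z"
proof (rule increment_eqI)
  fix a b :: real assume "a < b"
  then show "increment E {a..b} y = increment E {a..b} z"
    using assms unfolding has_rs_integral_iff by (blast intro: tendsto_unique[OF rs_filter_neq_bot])
qed

text \<open>A bounded family that is consistent under restriction consists of the increments of one
  vector: by Pythagoras the norms increase, so the family is Cauchy.\<close>

lemma consistent_family_vector:
  assumes cons: "\<And>a' a b b'. a' \<le> a \<Longrightarrow> a < b \<Longrightarrow> b \<le> b' \<Longrightarrow> increment E {a..b} (U a' b') = U a b"
    and bd: "\<And>a b. a < b \<Longrightarrow> norm (U a b) \<le> B"
  shows "\<exists>y. \<forall>a b. a < b \<longrightarrow> U a b = increment E {a..b} y"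
proof -
  define X where "X n = U (- real (Suc n)) (real (Suc n))" for n
  have pyth: "(norm (X m - X n))\<^sup>2 = (norm (X m))\<^sup>2 - (norm (X n))\<^sup>2" if "n \<le> m" for m n
  proof -
    let ?K = "{- real (Suc n)..real (Suc n)}"
    have inc: "increment E ?K (X m) = X n" "increment E ?K (X n) = X n"
      unfolding X_def by (rule cons; use that in simp)+
    have "cinner (X m) (X n) = cinner (X n) (X n)"
      using increment_selfadjoint[of ?K "X m" "X n"] by (simp only: inc)
    then show ?thesis
      using norm_diff_sq[of "X m" "X n"] by (simp add: norm_sq_cinner[symmetric])
  qed
  have "incseq (\<lambda>n. (norm (X n))\<^sup>2)"
    by (rule monoI) (metis diff_ge_0_iff_ge pyth zero_le_power2)
  moreover have "(norm (X n))\<^sup>2 \<le> B\<^sup>2" for n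
    unfolding X_def by (rule power_mono[OF bd]) auto
  ultimately have "Cauchy (\<lambda>n. (norm (X n))\<^sup>2)"
    using incseq_convergent LIMSEQ_imp_Cauchy by metis
  then have C: "\<exists>N. \<forall>m\<ge>N. \<forall>n\<ge>N. \<bar>(norm (X m))\<^sup>2 - (norm (X n))\<^sup>2\<bar> < e" if "e > 0" for e
    using that unfolding Cauchy_def by (auto simp: dist_real_def)
  have "Cauchy X"
  proof (rule metric_CauchyI)
    fix e :: real assume e: "e > 0"
    obtain N where N: "\<And>m n. m \<ge> N \<Longrightarrow> n \<ge> N \<Longrightarrow> \<bar>(norm (X m))\<^sup>2 - (norm (X n))\<^sup>2\<bar> < e\<^sup>2"
      using C[of "e\<^sup>2"] e by auto
    have le: "dist (X m) (X n) < e" if "m \<ge> n" "n \<ge> N" for m n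
    proof -
      have "(norm (X m - X n))\<^sup>2 < e\<^sup>2" using pyth[OF that(1)] N[of m n] that by auto
      then show ?thesis using e by (simp add: dist_norm power_less_imp_less_base)
    qed
    show "\<exists>N. \<forall>m\<ge>N. \<forall>n\<ge>N. dist (X m) (X n) < e"
      by (intro exI[of _ N] allI impI) (metis le dist_commute nat_le_linear)
  qed
  then obtain y where y: "X \<longlonglongrightarrow> y" using Cauchy_convergent convergent_def by blast
  have "U a b = increment E {a..b} y" if ab: "a < b" for a b
  proof (rule LIMSEQ_unique)
    show "(\<lambda>n. increment E {a..b} (X n)) \<longlonglongrightarrow> increment E {a..b} y" by (rule tendsto_increment[OF y])
    have "increment E {a..b} (X n) = U a b" if n: "n \<ge> nat \<lceil>max \<bar>a\<bar> \<bar>b\<bar>\<rceil>" for n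
      unfolding X_def by (rule cons[OF _ ab]) (use n in linarith)+
    then have "eventually (\<lambda>n. increment E {a..b} (X n) = U a b) sequentially"
      unfolding eventually_sequentially by blast
    then show "(\<lambda>n. increment E {a..b} (X n)) \<longlonglongrightarrow> U a b" by (rule tendsto_eventually)
  qed
  then show ?thesis by blast
qed

text \<open>Convergence of the norms at infinity suffices for the boundedness.\<close>

lemma consistent_family_vector_of_norm_limit:
  assumes cons: "\<And>a' a b b'. a' \<le> a \<Longrightarrow> a < b \<Longrightarrow> b \<le> b' \<Longrightarrow> increment E {a..b} (U a' b') = U a b"
    and lim: "((\<lambda>(a, b). complex_of_real ((norm (U a b))\<^sup>2)) \<longlongrightarrow> z) (at_bot \<times>\<^sub>F at_top)"
  shows "\<exists>y. \<forall>a b. a < b \<longrightarrow> U a b = increment E {a..b} y"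
proof (rule consistent_family_vector[OF cons])
  fix a b :: real assume ab: "a < b"
  have "eventually (\<lambda>w. cmod (case w of (a, b) \<Rightarrow> complex_of_real ((norm (U a b))\<^sup>2)) < cmod z + 1)
      (at_bot \<times>\<^sub>F at_top)"
    by (rule order_tendstoD[OF tendsto_norm[OF lim]]) simp
  then have "eventually (\<lambda>w. (case w of (a', b') \<Rightarrow> a' \<le> a \<and> b \<le> b') \<and>
      cmod (case w of (a, b) \<Rightarrow> complex_of_real ((norm (U a b))\<^sup>2)) < cmod z + 1) (at_bot \<times>\<^sub>F at_top)"
    using eventually_interval_contains[of a b] by (rule eventually_conj[rotated])
  then obtain w where w: "case w of (a', b') \<Rightarrow> a' \<le> a \<and> b \<le> b'"
      "cmod (case w of (a, b) \<Rightarrow> complex_of_real ((norm (U a b))\<^sup>2)) < cmod z + 1"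
    using eventually_happens'[OF at_bot_at_top_neq_bot] by blast
  obtain a' b' where "w = (a', b')" by (cases w)
  then have ab': "a' \<le> a" "b \<le> b'" "(norm (U a' b'))\<^sup>2 < cmod z + 1"
    using w by (auto simp: norm_power)
  have "norm (U a b) \<le> norm (U a' b')"
    using norm_increment_le[of a b "U a' b'"] cons[OF ab'(1) ab ab'(2)] ab by simp
  also have "\<dots> \<le> sqrt (cmod z + 1)"
    using ab'(3) by (intro real_le_rsqrt) simp
  finally show "norm (U a b) \<le> sqrt (cmod z + 1)" .
qed auto

lemma tendsto_norm_increment_sq:
  "((\<lambda>(a, b). complex_of_real ((norm (increment E {a..b} y))\<^sup>2)) \<longlongrightarrow> complex_of_real ((norm y)\<^sup>2))
     (at_bot \<times>\<^sub>F at_top)"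
proof -
  have "((\<lambda>w. complex_of_real ((norm (case w of (a, b) \<Rightarrow> increment E {a..b} y))\<^sup>2)) \<longlongrightarrow>
      complex_of_real ((norm y)\<^sup>2)) (at_bot \<times>\<^sub>F at_top)"
    by (intro tendsto_of_real tendsto_power tendsto_norm tendsto_increment_UNIV)
  then show ?thesis by (simp add: case_prod_unfold)
qed

section \<open>The integral of the identity function\<close>

text \<open>The sums for \<open>\<integral> x\<^sup>2 d\<langle>E\<^sub>x h, h\<rangle>\<close> are the squared norms of those for \<open>\<integral> x dE\<^sub>x h\<close>.\<close>

lemma sum_sq_cinner:
  assumes p: "p tagged_division_of {a..b}"
  shows "(\<Sum>(x, K)\<in>p. of_real (x\<^sup>2) * cinner (increment E K h) h)
    = complex_of_real ((norm (rsum (\<lambda>x. x *\<^sub>R h) p))\<^sup>2)"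
proof -
  have "(norm (rsum (\<lambda>x. x *\<^sub>R h) p))\<^sup>2 = (\<Sum>z\<in>p. (norm (increment E (snd z) (fst z *\<^sub>R h)))\<^sup>2)"
    unfolding rsum_def case_prod_beta
    by (rule norm_sum_sq_orthogonal)
      (use tagged_division_ofD(1)[OF p] rsum_cells_orthogonal[OF p] in auto)
  moreover have "complex_of_real ((norm (increment E (snd z) (fst z *\<^sub>R h)))\<^sup>2)
      = of_real ((fst z)\<^sup>2) * cinner (increment E (snd z) h) h" if "z \<in> p" for z
  proof -
    have z: "(fst z, snd z) \<in> p" using that by simp
    obtain c d where K: "snd z = {c..d}" "c \<le> d" using tagged_division_of_cell[OF p z] by blast
    have "complex_of_real ((norm (increment E (snd z) (fst z *\<^sub>R h)))\<^sup>2)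
        = of_real ((fst z)\<^sup>2) * cinner (increment E (snd z) h) (increment E (snd z) h)"
      by (simp add: increment_scaleR power_mult_distrib cinner_self)
    also have "cinner (increment E (snd z) h) (increment E (snd z) h) = cinner (increment E (snd z) h) h"
      using K by (metis increment_increment increment_selfadjoint Int_absorb)
    finally show ?thesis .
  qed
  ultimately show ?thesis by (simp add: case_prod_beta del: of_real_power)
qed

lemma tendsto_sq_integral:
  assumes "a \<le> b"
  shows "((\<lambda>p. \<Sum>(x, K)\<in>p. of_real (x\<^sup>2) * cinner (increment E K h) h)
    \<longlongrightarrow> complex_of_real ((norm (mult_op (\<lambda>x. x) a b h))\<^sup>2)) (rs_filter a b)"
proof (rule Lim_transform_eventually)
  show "((\<lambda>p. complex_of_real ((norm (rsum (\<lambda>x. x *\<^sub>R h) p))\<^sup>2))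
      \<longlongrightarrow> complex_of_real ((norm (mult_op (\<lambda>x. x) a b h))\<^sup>2)) (rs_filter a b)"
    using assms by (intro tendsto_of_real tendsto_power tendsto_norm tendsto_mult_const continuous_on_id)
  show "eventually (\<lambda>p. complex_of_real ((norm (rsum (\<lambda>x. x *\<^sub>R h) p))\<^sup>2)
      = (\<Sum>(x, K)\<in>p. of_real (x\<^sup>2) * cinner (increment E K h) h)) (rs_filter a b)"
    using eventually_rs_filter_tagged_division by eventually_elim (simp only: sum_sq_cinner)
qed

text \<open>A vector belongs to the domain of \<open>\<integral> x dE\<^sub>x\<close> if and only if its truncated images are the
  increments of one vector, which is then the value of the operator.\<close>

lemma resolution_of_operator_iff:
  assumes T: "resolution_of_operator E D T"
  shows "h \<in> D \<and> T h = k \<longleftrightarrow> (\<forall>a b. a < b \<longrightarrow> mult_op (\<lambda>x. x) a b h = increment E {a..b} k)"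
proof -
  let ?U = "\<lambda>a b. mult_op (\<lambda>x. x) a b h"
  have lim: "(rsum (\<lambda>x. x *\<^sub>R h) \<longlongrightarrow> ?U a b) (rs_filter a b)" if "a < b" for a b
    using that by (intro tendsto_mult_const continuous_on_id) simp
  have D: "h \<in> D \<longleftrightarrow> (\<exists>s. has_rs_integral (\<lambda>x K. of_real (x\<^sup>2) * cinner (increment E K h) h) s)"
    using T unfolding resolution_of_operator_def by blast
  have val: "\<forall>a b. a < b \<longrightarrow> ?U a b = increment E {a..b} (T h)" if "h \<in> D"
  proof -
    have "has_rs_integral (\<lambda>x K. increment E K (x *\<^sub>R h)) (T h)"
      using T that unfolding resolution_of_operator_def by (simp add: increment_scaleR)
    then show ?thesis
      unfolding has_rs_integral_iff using lim tendsto_unique[OF rs_filter_neq_bot] by blast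
  qed
  have "h \<in> D" if k: "\<forall>a b. a < b \<longrightarrow> ?U a b = increment E {a..b} k"
  proof -
    have "((\<lambda>p. \<Sum>(x, K)\<in>p. of_real (x\<^sup>2) * cinner (increment E K h) h)
        \<longlongrightarrow> complex_of_real ((norm (increment E {a..b} k))\<^sup>2)) (rs_filter a b)" if "a < b" for a b
      using tendsto_sq_integral[of a b h] that k by simp
    then show ?thesis
      unfolding D has_rs_integral_def
      by (intro exI[of _ "complex_of_real ((norm k)\<^sup>2)"]
          exI[of _ "\<lambda>a b. complex_of_real ((norm (increment E {a..b} k))\<^sup>2)"] conjI allI impI
          tendsto_norm_increment_sq)
  qed
  then show ?thesis
    using val increment_eqI[of "T h" k] by metis
qed

section \<open>Projections as limits of continuous integrals\<close>

lemma mult_const_on: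
  assumes ab: "a \<le> b" and c: "\<And>x. x \<in> {a..b} \<Longrightarrow> \<phi> x = c"
  shows "mult_op \<phi> a b h = c *\<^sub>R increment E {a..b} h"
proof -
  have \<phi>: "continuous_on {a..b} \<phi>"
    using continuous_on_cong[of "{a..b}" "{a..b}" \<phi> "\<lambda>_. c"] c by simp
  have "eventually (\<lambda>p. rsum (\<lambda>x. \<phi> x *\<^sub>R h) p = c *\<^sub>R increment E {a..b} h) (rs_filter a b)"
    using eventually_rs_filter_tagged_division
  proof eventually_elim
    case (elim p)
    have "rsum (\<lambda>x. \<phi> x *\<^sub>R h) p = rsum (\<lambda>x. c *\<^sub>R h) p"
      unfolding rsum_def
    proof (rule sum.cong)
      fix z assume "z \<in> p"
      then obtain x K where z: "z = (x, K)" "(x, K) \<in> p" by (cases z) auto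
      have "\<phi> x = c" by (rule tagged_division_of_cell[OF elim z(2)]) (simp add: c)
      then show "(case z of (x, K) \<Rightarrow> increment E K (\<phi> x *\<^sub>R h)) = (case z of (x, K) \<Rightarrow> increment E K (c *\<^sub>R h))"
        by (simp add: z)
    qed simp
    then show ?case by (simp add: rsum_const[OF ab elim] increment_scaleR)
  qed
  then have "(rsum (\<lambda>x. \<phi> x *\<^sub>R h) \<longlongrightarrow> c *\<^sub>R increment E {a..b} h) (rs_filter a b)"
    by (rule tendsto_eventually)
  then show ?thesis
    using tendsto_unique[OF rs_filter_neq_bot tendsto_mult_const[OF ab \<phi>]] by blast
qed

lemma has_rs_integral_bounded_continuous:
  assumes \<phi>: "continuous_on UNIV \<phi>" and M: "\<And>x. \<bar>\<phi> x\<bar> \<le> M"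
  shows "\<exists>y. has_rs_integral (\<lambda>x K. increment E K (\<phi> x *\<^sub>R h)) y \<and>
    (\<forall>a b. a < b \<longrightarrow> mult_op \<phi> a b h = increment E {a..b} y)"
proof -
  have cont: "continuous_on {a..b} \<phi>" for a b using \<phi> continuous_on_subset by blast
  have lim: "(rsum (\<lambda>x. \<phi> x *\<^sub>R h) \<longlongrightarrow> mult_op \<phi> a b h) (rs_filter a b)" if "a < b" for a b
    using that by (intro tendsto_mult_const cont) simp
  have M0: "0 \<le> M" using M[of 0] by linarith
  have "\<exists>y. \<forall>a b. a < b \<longrightarrow> mult_op \<phi> a b h = increment E {a..b} y"
  proof (rule consistent_family_vector)
    show "increment E {a..b} (mult_op \<phi> a' b' h) = mult_op \<phi> a b h" if "a' \<le> a" "a < b" "b \<le> b'" for a' a b b'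
      using that by (intro increment_integral_restrict[OF _ _ _ lim lim]) auto
    show "norm (mult_op \<phi> a b h) \<le> M * norm h" if "a < b" for a b
      using that by (intro norm_mult_le cont M0 M) simp
  qed
  then show ?thesis
    unfolding has_rs_integral_iff using lim by metis
qed

text \<open>For \<open>\<delta> > 0\<close>, the continuous piecewise linear function that is one up to \<open>b\<close> and zero from
  \<open>b + \<delta>\<close> on.\<close>

definition cutoff :: "real \<Rightarrow> real \<Rightarrow> real \<Rightarrow> real" where
  "cutoff b \<delta> x = max 0 (min 1 (1 - (x - b) / \<delta>))"

text \<open>The integral of the cutoff function agrees with \<open>E b\<close> except on \<open>(b, b + \<delta>]\<close>, where it multiplies
  by numbers between zero and one.\<close>

lemma integral_cutoff_approx:
  assumes \<delta>: "\<delta> > 0"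
  shows "\<exists>y. has_rs_integral (\<lambda>x K. increment E K (cutoff b \<delta> x *\<^sub>R h)) y \<and>
    norm (y - E b h) \<le> norm (E (b + \<delta>) h - E b h)"
proof -
  let ?\<phi> = "cutoff b \<delta>"
  have cont: "continuous_on A ?\<phi>" for A
    unfolding cutoff_def by (intro continuous_intros) (use \<delta> in auto)
  have one: "\<bar>?\<phi> x\<bar> \<le> 1" for x unfolding cutoff_def by auto
  obtain y where y: "has_rs_integral (\<lambda>x K. increment E K (?\<phi> x *\<^sub>R h)) y"
    and mult_op: "\<And>a c. a < c \<Longrightarrow> mult_op ?\<phi> a c h = increment E {a..c} y"
    using has_rs_integral_bounded_continuous[OF cont one] by blast
  have bound: "norm (increment E {a..c} y - (E b h - E a h)) \<le> norm (E (b + \<delta>) h - E b h)"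
    if ac: "a < b" "b + \<delta> < c" for a c
  proof -
    have "increment E {a..c} y = increment E {a..b} y + increment E {b..b + \<delta>} y + increment E {b + \<delta>..c} y"
      using ac \<delta> by (simp add: increment_interval)
    moreover have "increment E {a..b} y = E b h - E a h"
    proof -
      have "mult_op ?\<phi> a b h = 1 *\<^sub>R increment E {a..b} h"
        by (rule mult_const_on) (use ac \<delta> in \<open>auto simp: cutoff_def divide_le_0_iff\<close>)
      then show ?thesis using mult_op[of a b] ac by (simp add: increment_interval)
    qed
    moreover have "increment E {b + \<delta>..c} y = 0"
    proof -
      have "mult_op ?\<phi> (b + \<delta>) c h = 0 *\<^sub>R increment E {b + \<delta>..c} h"
        by (rule mult_const_on) (use ac \<delta> in \<open>auto simp: cutoff_def le_divide_eq\<close>)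
      then show ?thesis using mult_op[of "b + \<delta>" c] ac by simp
    qed
    ultimately have "increment E {a..c} y - (E b h - E a h) = mult_op ?\<phi> b (b + \<delta>) (increment E {b..b + \<delta>} h)"
      using mult_op[of b "b + \<delta>"] \<delta> by (simp add: mult_increment cont)
    also have "norm \<dots> \<le> 1 * norm (increment E {b..b + \<delta>} h)"
      using \<delta> one by (intro norm_mult_le cont) auto
    finally show ?thesis using \<delta> by (simp add: increment_interval)
  qed
  have "norm (y - (E b h - 0)) \<le> norm (E (b + \<delta>) h - E b h)"
  proof (rule tendsto_upperbound)
    show "((\<lambda>w. norm ((case w of (a, c) \<Rightarrow> increment E {a..c} y) - (E b h - E (fst w) h)))
        \<longlongrightarrow> norm (y - (E b h - 0))) (at_bot \<times>\<^sub>F at_top)"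
      by (intro tendsto_norm tendsto_diff tendsto_const tendsto_increment_UNIV
          filterlim_compose[OF E_at_bot filterlim_fst])
    show "eventually (\<lambda>w. norm ((case w of (a, c) \<Rightarrow> increment E {a..c} y) - (E b h - E (fst w) h))
        \<le> norm (E (b + \<delta>) h - E b h)) (at_bot \<times>\<^sub>F at_top)"
      using eventually_interval_contains[of "b - 1" "b + \<delta> + 1"]
      by eventually_elim (auto intro!: bound)
  qed simp
  then show ?thesis using y by auto
qed

text \<open>Right-continuity of \<open>E\<close> makes the error in \<open>integral_cutoff_approx\<close> tend to zero as \<open>\<delta> \<rightarrow> 0\<close>.\<close>

lemma E_in_closed:
  assumes "closed M"
    and in_M: "\<And>\<delta> y. \<delta> > 0 \<Longrightarrow> has_rs_integral (\<lambda>x K. increment E K (cutoff b \<delta> x *\<^sub>R h)) y \<Longrightarrow> y \<in> M"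
  shows "E b h \<in> M"
proof -
  have "\<forall>n. \<exists>y. has_rs_integral (\<lambda>x K. increment E K (cutoff b (inverse (real (Suc n))) x *\<^sub>R h)) y \<and>
      norm (y - E b h) \<le> norm (E (b + inverse (real (Suc n))) h - E b h)"
    by (intro allI integral_cutoff_approx) simp
  then obtain Y where Y: "\<And>n. has_rs_integral (\<lambda>x K. increment E K (cutoff b (inverse (real (Suc n))) x *\<^sub>R h)) (Y n)"
    and le: "\<And>n. norm (Y n - E b h) \<le> norm (E (b + inverse (real (Suc n))) h - E b h)"
    by metis
  have YM: "Y n \<in> M" for n by (rule in_M[OF _ Y]) simp
  have "filterlim (\<lambda>n. b + inverse (real (Suc n))) (at_right b) sequentially"
    unfolding filterlim_at
    using tendsto_add[OF tendsto_const LIMSEQ_inverse_real_of_nat, of b] by simp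
  then have "(\<lambda>n. E (b + inverse (real (Suc n))) h) \<longlonglongrightarrow> E b h"
    by (rule filterlim_compose[OF E_right_continuous])
  then have "(\<lambda>n. norm (E (b + inverse (real (Suc n))) h - E b h)) \<longlonglongrightarrow> 0"
    using tendsto_norm_zero LIM_zero by blast
  then have "(\<lambda>n. Y n - E b h) \<longlonglongrightarrow> 0"
    by (rule Lim_null_comparison[rotated]) (use le in simp)
  then have "Y \<longlonglongrightarrow> E b h" by (rule LIM_zero_cancel)
  then show ?thesis using closed_sequentially[OF assms(1)] YM by blast
qed

text \<open>The net \<open>E x h\<close> for \<open>x\<close> increasing in \<open>D\<close> converges because the norms increase.\<close>

lemma E_ray_in_closed:
  assumes M: "closed M" "0 \<in> M" "\<And>x. E x h \<in> M"
  shows "E_ray E D h \<in> M"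
proof (cases "D = {}")
  case False
  define \<F> where "\<F> = (INF x\<in>D. principal (D \<inter> {x..}))"
  have ev: "eventually P \<F> \<longleftrightarrow> (\<exists>x\<in>D. \<forall>y\<in>D \<inter> {x..}. P y)" for P
  proof -
    have "\<exists>z\<in>D. principal (D \<inter> {z..}) \<le> inf (principal (D \<inter> {x..})) (principal (D \<inter> {y..}))"
      if "x \<in> D" "y \<in> D" for x y
      using that by (intro bexI[of _ "max x y"]) (auto simp: max_def)
    then show ?thesis
      unfolding \<F>_def using False by (subst eventually_INF_base) (auto simp: eventually_principal)
  qed
  have nb: "\<F> \<noteq> bot"
  proof
    assume "\<F> = bot"
    then have "eventually (\<lambda>_. False) \<F>" by simp
    then show False unfolding ev by auto
  qed
  have pyth: "(norm (E y h - E x h))\<^sup>2 = (norm (E y h))\<^sup>2 - (norm (E x h))\<^sup>2" if "x \<le> y" for x y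
  proof -
    have "cinner (E y h) (E x h) = cinner (E x h) (E x h)"
      using that E_selfadjoint[of x "E y h" "h"] E_selfadjoint[of x "E x h" "h"]
      by (metis E_E E_selfadjoint min.absorb1 min.idem min.commute)
    then show ?thesis
      using norm_diff_sq[of "E y h" "E x h"] by (simp add: norm_sq_cinner[symmetric])
  qed
  have mono: "(norm (E x h))\<^sup>2 \<le> (norm (E y h))\<^sup>2" if "x \<le> y" for x y
    using pyth[OF that] zero_le_power2[of "norm (E y h - E x h)"] by linarith
  have bd: "(norm (E x h))\<^sup>2 \<le> (norm h)\<^sup>2" for x
  proof (rule tendsto_lowerbound)
    show "((\<lambda>y. (norm (E y h))\<^sup>2) \<longlongrightarrow> (norm h)\<^sup>2) at_top"
      by (intro tendsto_power tendsto_norm E_at_top)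
    show "eventually (\<lambda>y. (norm (E x h))\<^sup>2 \<le> (norm (E y h))\<^sup>2) at_top"
      using eventually_ge_at_top[of x] by eventually_elim (rule mono)
  qed simp
  define s where "s = (SUP x\<in>D. (norm (E x h))\<^sup>2)"
  have bdd: "bdd_above ((\<lambda>x. (norm (E x h))\<^sup>2) ` D)" using bd by (intro bdd_aboveI2)
  have "\<exists>l. ((\<lambda>x. E x h) \<longlongrightarrow> l) \<F>"
  proof (rule tendsto_of_cauchy_net[OF nb])
    fix e :: real assume e: "e > 0"
    then have "s - e\<^sup>2 < s" by simp
    then obtain x where x: "x \<in> D" "s - e\<^sup>2 < (norm (E x h))\<^sup>2"
      unfolding s_def using less_cSUP_iff[OF False bdd] by blast
    have le: "dist (E y h) (E z h) < e" if "y \<in> D" "z \<in> D" "x \<le> z" "z \<le> y" for y z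
    proof -
      have "(norm (E y h))\<^sup>2 \<le> s" unfolding s_def using that bdd by (intro cSUP_upper)
      moreover have "(norm (E x h))\<^sup>2 \<le> (norm (E z h))\<^sup>2" using that by (intro mono)
      ultimately have "(norm (E y h - E z h))\<^sup>2 < e\<^sup>2" using x(2) pyth[OF that(4)] by linarith
      then show ?thesis using e by (simp add: dist_norm power_less_imp_less_base)
    qed
    show "\<exists>P. eventually P \<F> \<and> (\<forall>y z. P y \<and> P z \<longrightarrow> dist (E y h) (E z h) < e)"
    proof (intro exI[of _ "\<lambda>y. y \<in> D \<and> x \<le> y"] conjI allI impI)
      show "eventually (\<lambda>y. y \<in> D \<and> x \<le> y) \<F>" unfolding ev using x(1) by auto
      show "dist (E y h) (E z h) < e" if "(y \<in> D \<and> x \<le> y) \<and> (z \<in> D \<and> x \<le> z)" for y z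
        using that le[of y z] le[of z y] by (cases "z \<le> y") (auto simp: dist_commute)
    qed
  qed
  then obtain l where l: "((\<lambda>x. E x h) \<longlongrightarrow> l) \<F>" ..
  have "l \<in> M" by (rule Lim_in_closed_set[OF M(1) _ nb l]) (simp add: M(3))
  moreover have "E_ray E D h = l"
    using tendsto_Lim[OF nb l] False by (simp add: E_ray_def \<F>_def)
  ultimately show ?thesis by simp
qed (simp add: E_ray_def M)

lemma E_interval_in_closed:
  assumes M: "closed M" "csubspace M" "\<And>x. E x h \<in> M"
  shows "E_interval E \<Delta> h \<in> M"
  unfolding E_interval_def Let_def
  by (intro csubspace_diff M(2) E_ray_in_closed M csubspace_zero)

lemma generating_subspace_dense:
  assumes "generating_subspace E G" and M: "closed M" "csubspace M" "\<And>x h. h \<in> G \<Longrightarrow> E x h \<in> M"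
  shows "M = UNIV"
proof -
  obtain f L where L: "\<And>k. L k = closed_cspan {E_interval E \<Delta> (f k) |\<Delta>. is_interval \<Delta>}"
    and total: "closed_cspan (\<Union>k::nat. L k) = UNIV" and G: "G = closed_cspan (range f)"
    using assms(1) unfolding generating_subspace_def by blast
  have "f k \<in> G" for k unfolding G by (rule subsetD[OF closed_cspan_superset]) simp
  then have "E_interval E \<Delta> (f k) \<in> M" for \<Delta> k
    by (intro E_interval_in_closed M)
  then have "L k \<subseteq> M" for k
    unfolding L by (intro closed_cspan_minimal M) blast
  then have "closed_cspan (\<Union>k. L k) \<subseteq> M"
    by (intro closed_cspan_minimal M) blast
  then show ?thesis using total by blast
qed

end

section \<open>Completions of semi-inner product spaces\<close>

text \<open>A space with a semi-definite form, mapped isometrically by \<open>W\<close> into a Hilbert space.  Cauchy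
  sequences and null sequences are recognised by their images, and the completion is identified with
  the closure of the range of \<open>W\<close>.\<close>

locale isometric_map =
  fixes P :: "'a ip_space" and W :: "'a \<Rightarrow> 'h::complex_hilbert_space"
  assumes vadd_closed: "u \<in> carrier P \<Longrightarrow> v \<in> carrier P \<Longrightarrow> vadd P u v \<in> carrier P"
    and W_vadd: "u \<in> carrier P \<Longrightarrow> v \<in> carrier P \<Longrightarrow> W (vadd P u v) = W u + W v"
    and vscale_closed: "u \<in> carrier P \<Longrightarrow> vscale P c u \<in> carrier P"
    and W_vscale: "u \<in> carrier P \<Longrightarrow> W (vscale P c u) = c *\<^sub>C W u"
    and W_ip: "u \<in> carrier P \<Longrightarrow> v \<in> carrier P \<Longrightarrow> ip P u v = cinner (W u) (W v)"
begin

lemma ipdist_eq: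
  assumes "u \<in> carrier P" "v \<in> carrier P"
  shows "ipdist P u v = dist (W u) (W v)"
proof -
  have "W (vadd P u (vscale P (-1) v)) = W u - W v"
    using assms by (simp add: W_vadd W_vscale vscale_closed scaleC_minus_one)
  then show ?thesis
    using assms by (simp add: ipdist_def Let_def W_ip vadd_closed vscale_closed norm_sq_cinner[symmetric] dist_norm)
qed

lemma cauchy_seqs_iff: "X \<in> cauchy_seqs P \<longleftrightarrow> (\<forall>n. X n \<in> carrier P) \<and> Cauchy (\<lambda>n. W (X n))"
  unfolding cauchy_seqs_def Cauchy_def by (auto simp: ipdist_eq)

text \<open>The limit of the images of a Cauchy sequence.  Two Cauchy sequences are equivalent if and only
  if these limits agree.\<close>

definition limit :: "(nat \<Rightarrow> 'a) \<Rightarrow> 'h" where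
  "limit X = lim (\<lambda>n. W (X n))"

lemma tendsto_limit: "X \<in> cauchy_seqs P \<Longrightarrow> (\<lambda>n. W (X n)) \<longlonglongrightarrow> limit X"
  unfolding limit_def cauchy_seqs_iff using Cauchy_convergent convergent_LIMSEQ_iff by blast

lemma cauchy_seqsI:
  assumes "\<And>n. X n \<in> carrier P" "(\<lambda>n. W (X n)) \<longlonglongrightarrow> h"
  shows "X \<in> cauchy_seqs P" "limit X = h"
  using assms LIMSEQ_imp_Cauchy[of "\<lambda>n. W (X n)" h] limI[of "\<lambda>n. W (X n)" h]
  by (auto simp: cauchy_seqs_iff limit_def)

lemma null_rel_iff: "(X, Y) \<in> null_rel P \<longleftrightarrow> X \<in> cauchy_seqs P \<and> Y \<in> cauchy_seqs P \<and> limit X = limit Y"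
proof (cases "X \<in> cauchy_seqs P \<and> Y \<in> cauchy_seqs P")
  case True
  then have "(\<lambda>n. ipdist P (X n) (Y n)) = (\<lambda>n. dist (W (X n)) (W (Y n)))"
    by (auto simp: ipdist_eq cauchy_seqs_iff)
  moreover have "(\<lambda>n. dist (W (X n)) (W (Y n))) \<longlonglongrightarrow> dist (limit X) (limit Y)"
    using True by (intro tendsto_dist tendsto_limit) auto
  ultimately have "(\<lambda>n. ipdist P (X n) (Y n)) \<longlonglongrightarrow> 0 \<longleftrightarrow> dist (limit X) (limit Y) = 0"
    by (metis LIMSEQ_unique)
  then show ?thesis using True by (simp add: null_rel_def)
qed (auto simp: null_rel_def)

lemma class_eq: "X \<in> cauchy_seqs P \<Longrightarrow> null_rel P `` {X} = {Y \<in> cauchy_seqs P. limit Y = limit X}"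
  by (auto simp: null_rel_iff)

lemma carrier_completion: "carrier (completion P) = (\<lambda>X. null_rel P `` {X}) ` cauchy_seqs P"
  by (auto simp: completion_def quotient_def)

text \<open>The extension of \<open>W\<close> by continuity to classes of Cauchy sequences; outside the carrier of the
  completion its values have no meaning.\<close>

definition extension :: "(nat \<Rightarrow> 'a) set \<Rightarrow> 'h" where
  "extension A = (THE h. \<forall>X\<in>A. (\<lambda>n. W (X n)) \<longlonglongrightarrow> h)"

lemma extension_class:
  assumes X: "X \<in> cauchy_seqs P"
  shows "extension (null_rel P `` {X}) = limit X"
  unfolding extension_def class_eq[OF X]
proof (rule the_equality)
  show "\<forall>Y\<in>{Y \<in> cauchy_seqs P. limit Y = limit X}. (\<lambda>n. W (Y n)) \<longlonglongrightarrow> limit X"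
    using tendsto_limit by force
  show "h = limit X" if "\<forall>Y\<in>{Y \<in> cauchy_seqs P. limit Y = limit X}. (\<lambda>n. W (Y n)) \<longlonglongrightarrow> h" for h
    using that X tendsto_limit[OF X] LIMSEQ_unique by blast
qed

lemma tendsto_extension:
  assumes "A \<in> carrier (completion P)" "X \<in> A"
  shows "X n \<in> carrier P" "(\<lambda>n. W (X n)) \<longlonglongrightarrow> extension A"
proof -
  obtain Y where Y: "Y \<in> cauchy_seqs P" "A = null_rel P `` {Y}"
    using assms(1) by (auto simp: carrier_completion)
  then have "X \<in> cauchy_seqs P" "limit X = extension A"
    using assms(2) by (auto simp: extension_class[OF Y(1)] null_rel_iff)
  then show "X n \<in> carrier P" "(\<lambda>n. W (X n)) \<longlonglongrightarrow> extension A"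
    using tendsto_limit[of X] by (auto simp: cauchy_seqs_iff)
qed

lemma completion_nonempty: "A \<in> carrier (completion P) \<Longrightarrow> A \<noteq> {}"
  by (auto simp: carrier_completion null_rel_iff)

lemma extension_emb:
  assumes "u \<in> carrier P"
  shows "extension (completion_emb P u) = W u"
  unfolding completion_emb_def using cauchy_seqsI[of "\<lambda>_. u" "W u"] assms
  by (simp add: extension_class)

lemma vadd_completion:
  assumes X: "X \<in> cauchy_seqs P" and Y: "Y \<in> cauchy_seqs P"
  defines "Z \<equiv> \<lambda>n. vadd P (X n) (Y n)"
  shows "Z \<in> cauchy_seqs P" "limit Z = limit X + limit Y"
    "vadd (completion P) (null_rel P `` {X}) (null_rel P `` {Y}) = null_rel P `` {Z}"
proof -
  have sum: "(\<lambda>n. vadd P (X' n) (Y' n)) \<in> cauchy_seqs P"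
    "limit (\<lambda>n. vadd P (X' n) (Y' n)) = limit X' + limit Y'"
    if "X' \<in> cauchy_seqs P" "Y' \<in> cauchy_seqs P" for X' Y'
  proof -
    have "\<And>n. X' n \<in> carrier P" "\<And>n. Y' n \<in> carrier P" using that by (auto simp: cauchy_seqs_iff)
    then have "\<And>n. vadd P (X' n) (Y' n) \<in> carrier P" "(\<lambda>n. W (vadd P (X' n) (Y' n))) \<longlonglongrightarrow> limit X' + limit Y'"
      using tendsto_add[OF tendsto_limit[OF that(1)] tendsto_limit[OF that(2)]]
      by (simp_all add: vadd_closed W_vadd)
    then show "(\<lambda>n. vadd P (X' n) (Y' n)) \<in> cauchy_seqs P"
      "limit (\<lambda>n. vadd P (X' n) (Y' n)) = limit X' + limit Y'" by (rule cauchy_seqsI)+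
  qed
  show Z: "Z \<in> cauchy_seqs P" "limit Z = limit X + limit Y"
    unfolding Z_def using sum X Y by blast+
  have "null_rel P `` {\<lambda>n. vadd P (X' n) (Y' n)} = null_rel P `` {Z}"
    if "X' \<in> null_rel P `` {X}" "Y' \<in> null_rel P `` {Y}" for X' Y'
    using that Z sum[of X' Y'] X Y by (simp add: class_eq)
  moreover have "X \<in> null_rel P `` {X}" "Y \<in> null_rel P `` {Y}" using X Y by (simp_all add: null_rel_iff)
  ultimately show "vadd (completion P) (null_rel P `` {X}) (null_rel P `` {Y}) = null_rel P `` {Z}"
    unfolding completion_def by (simp del: Image_singleton_iff) blast
qed

lemma vscale_completion:
  fixes c :: complex
  assumes X: "X \<in> cauchy_seqs P"
  defines "Z \<equiv> \<lambda>n. vscale P c (X n)"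
  shows "Z \<in> cauchy_seqs P" "limit Z = c *\<^sub>C limit X"
    "vscale (completion P) c (null_rel P `` {X}) = null_rel P `` {Z}"
proof -
  have scale: "(\<lambda>n. vscale P c (X' n)) \<in> cauchy_seqs P"
    "limit (\<lambda>n. vscale P c (X' n)) = c *\<^sub>C limit X'"
    if "X' \<in> cauchy_seqs P" for X'
  proof -
    have "\<And>n. X' n \<in> carrier P" using that by (auto simp: cauchy_seqs_iff)
    then have "\<And>n. vscale P c (X' n) \<in> carrier P" "(\<lambda>n. W (vscale P c (X' n))) \<longlonglongrightarrow> c *\<^sub>C limit X'"
      using tendsto_scaleC[OF tendsto_limit[OF that]]
      by (simp_all add: vscale_closed W_vscale)
    then show "(\<lambda>n. vscale P c (X' n)) \<in> cauchy_seqs P"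
      "limit (\<lambda>n. vscale P c (X' n)) = c *\<^sub>C limit X'" by (rule cauchy_seqsI)+
  qed
  show Z: "Z \<in> cauchy_seqs P" "limit Z = c *\<^sub>C limit X"
    unfolding Z_def using scale X by blast+
  have "null_rel P `` {\<lambda>n. vscale P c (X' n)} = null_rel P `` {Z}"
    if "X' \<in> null_rel P `` {X}" for X'
    using that Z scale[of X'] X by (simp add: class_eq)
  moreover have "X \<in> null_rel P `` {X}" using X by (simp add: null_rel_iff)
  ultimately show "vscale (completion P) c (null_rel P `` {X}) = null_rel P `` {Z}"
    unfolding completion_def by (simp del: Image_singleton_iff) blast
qed

lemma ip_completion:
  assumes X: "X \<in> cauchy_seqs P" and Y: "Y \<in> cauchy_seqs P"
  shows "ip (completion P) (null_rel P `` {X}) (null_rel P `` {Y}) = cinner (limit X) (limit Y)"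
proof -
  let ?A = "null_rel P `` {X}" and ?B = "null_rel P `` {Y}"
  have conv: "(\<lambda>n. ip P (X' n) (Y' n)) \<longlonglongrightarrow> cinner (limit X) (limit Y)" if "X' \<in> ?A" "Y' \<in> ?B" for X' Y'
  proof -
    have c: "X' \<in> cauchy_seqs P" "Y' \<in> cauchy_seqs P" "limit X' = limit X" "limit Y' = limit Y"
      using that by (auto simp: null_rel_iff)
    then have "(\<lambda>n. cinner (W (X' n)) (W (Y' n))) \<longlonglongrightarrow> cinner (limit X) (limit Y)"
      using cinner.tendsto[OF tendsto_limit[OF c(1)] tendsto_limit[OF c(2)]] by simp
    then show ?thesis using c by (simp add: W_ip cauchy_seqs_iff)
  qed
  have "X \<in> ?A" "Y \<in> ?B" using X Y by (simp_all add: null_rel_iff)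
  then have "(THE z. \<forall>X\<in>?A. \<forall>Y\<in>?B. (\<lambda>n. ip P (X n) (Y n)) \<longlonglongrightarrow> z) = cinner (limit X) (limit Y)"
    using conv by (intro the_equality) (blast, blast intro: LIMSEQ_unique)
  then show ?thesis by (simp add: completion_def)
qed

lemma completion_closed:
  shows "A \<in> carrier (completion P) \<Longrightarrow> B \<in> carrier (completion P) \<Longrightarrow> vadd (completion P) A B \<in> carrier (completion P)"
    and "A \<in> carrier (completion P) \<Longrightarrow> vscale (completion P) c A \<in> carrier (completion P)"
  unfolding carrier_completion
  by (auto simp: vadd_completion(3) vscale_completion(3) intro!: imageI vadd_completion(1) vscale_completion(1))

theorem unitary_extension:
  assumes dense: "closure (W ` carrier P) = UNIV"
  shows "unitary_iso (completion P) whole_space extension"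
proof -
  have "bij_betw extension (carrier (completion P)) UNIV"
  proof (rule bij_betw_imageI)
    show "inj_on extension (carrier (completion P))"
    proof (rule inj_onI)
      fix A B assume AB: "A \<in> carrier (completion P)" "B \<in> carrier (completion P)"
        and eq: "extension A = extension B"
      from AB obtain X Y where XY: "X \<in> cauchy_seqs P" "A = null_rel P `` {X}"
        "Y \<in> cauchy_seqs P" "B = null_rel P `` {Y}" by (auto simp: carrier_completion)
      have "limit X = limit Y" using eq XY by (simp add: extension_class)
      then show "A = B" using XY by (simp add: class_eq)
    qed
    have "h \<in> extension ` carrier (completion P)" for h :: 'h
    proof -
      have "h \<in> closure (W ` carrier P)" using dense by simp
      then obtain Z where Z: "\<And>n. Z n \<in> W ` carrier P" "Z \<longlonglongrightarrow> h" unfolding closure_sequential by blast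
      then have "\<forall>n. \<exists>x. x \<in> carrier P \<and> Z n = W x" by blast
      then obtain X where X: "\<And>n. X n \<in> carrier P" "\<And>n. Z n = W (X n)" by metis
      have "(\<lambda>n. W (X n)) \<longlonglongrightarrow> h" using Z(2) X(2) by (simp add: X(2)[symmetric])
      note c = cauchy_seqsI[OF X(1) this]
      show ?thesis
        using c by (force simp: carrier_completion extension_class image_image)
    qed
    then show "extension ` carrier (completion P) = UNIV" by blast
  qed
  then show ?thesis
    unfolding unitary_iso_def whole_space_def carrier_completion
    by (auto simp: vadd_completion vscale_completion ip_completion extension_class)
qed

end

text \<open>Self-adjointness is invariant under unitary equivalence.\<close>

lemma self_adjoint_unitary_transfer:
  fixes D :: "'h::complex_hilbert_space set"
  assumes V: "unitary_iso P whole_space V"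
    and closed: "\<And>u v. u \<in> carrier P \<Longrightarrow> v \<in> carrier P \<Longrightarrow> vadd P u v \<in> carrier P"
      "\<And>c u. u \<in> carrier P \<Longrightarrow> vscale P c u \<in> carrier P"
    and T: "self_adjoint whole_space D T"
    and D': "D' = {u \<in> carrier P. V u \<in> D}"
    and T': "\<And>u. u \<in> D' \<Longrightarrow> T' u \<in> carrier P" "\<And>u. u \<in> D' \<Longrightarrow> V (T' u) = T (V u)"
  shows "self_adjoint P D' T'"
proof -
  have bij: "inj_on V (carrier P)" "V ` carrier P = UNIV"
    and add: "\<And>u v. u \<in> carrier P \<Longrightarrow> v \<in> carrier P \<Longrightarrow> V (vadd P u v) = V u + V v"
    and sc: "\<And>c u. u \<in> carrier P \<Longrightarrow> V (vscale P c u) = c *\<^sub>C V u"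
    and ip: "\<And>u v. u \<in> carrier P \<Longrightarrow> v \<in> carrier P \<Longrightarrow> ip P u v = cinner (V u) (V v)"
    using V by (auto simp: unitary_iso_def whole_space_def bij_betw_def)
  interpret isometric_map P V
    by standard (simp_all add: closed add sc ip)
  interpret whole: isometric_map "whole_space :: 'h ip_space" "\<lambda>x. x"
    by standard (simp_all add: whole_space_def)
  have pre: "\<exists>u\<in>carrier P. V u = h" for h using bij(2) by (metis UNIV_I image_iff)
  have wdist: "ipdist whole_space u v = dist u v" for u v :: 'h
    by (rule whole.ipdist_eq) (simp_all add: whole_space_def)
  have T_add: "\<And>u v. u \<in> D \<Longrightarrow> v \<in> D \<Longrightarrow> u + v \<in> D \<and> T (u + v) = T u + T v"
    and T_sc: "\<And>c u. u \<in> D \<Longrightarrow> c *\<^sub>C u \<in> D \<and> T (c *\<^sub>C u) = c *\<^sub>C T u"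
    and dense: "\<And>u e. e > 0 \<Longrightarrow> \<exists>v\<in>D. dist u v < e"
    and adj: "\<And>v w. (\<forall>u\<in>D. cinner (T u) v = cinner u w) \<longleftrightarrow> (v \<in> D \<and> T v = w)"
    using T unfolding self_adjoint_def wdist by (simp_all add: whole_space_def)
  have eqI: "u = v" if "u \<in> carrier P" "v \<in> carrier P" "V u = V v" for u v
    using inj_onD[OF bij(1)] that by blast
  show ?thesis
    unfolding self_adjoint_def
  proof (intro conjI ballI allI impI)
    show "D' \<subseteq> carrier P" "T' ` D' \<subseteq> carrier P" using T'(1) by (auto simp: D')
  next
    fix u v assume uv: "u \<in> D'" "v \<in> D'"
    then show m: "vadd P u v \<in> D'" using T_add by (simp add: D' closed add)
    show "T' (vadd P u v) = vadd P (T' u) (T' v)"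
      by (rule eqI) (use uv m T' T_add in \<open>simp_all add: closed add D'\<close>)
  next
    fix c u assume u: "u \<in> D'"
    then show m: "vscale P c u \<in> D'" using T_sc by (simp add: D' closed sc)
    show "T' (vscale P c u) = vscale P c (T' u)"
      by (rule eqI) (use u m T' T_sc in \<open>simp_all add: closed sc D'\<close>)
  next
    fix u and e :: real assume u: "u \<in> carrier P" and e: "e > 0"
    obtain h where h: "h \<in> D" "dist (V u) h < e" using dense[OF e] by blast
    obtain v where "v \<in> carrier P" "V v = h" using pre by blast
    then show "\<exists>v\<in>D'. ipdist P u v < e" using h u by (auto simp: D' ipdist_eq)
  next
    fix v w assume v: "v \<in> carrier P" and w: "w \<in> carrier P"
    have "(\<forall>u\<in>D'. ip P (T' u) v = ip P u w) \<longleftrightarrow> (\<forall>u\<in>D'. cinner (T (V u)) (V v) = cinner (V u) (V w))"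
      using v w T' by (intro ball_cong refl) (simp add: ip D')
    also have "\<dots> \<longleftrightarrow> (\<forall>h\<in>D. cinner (T h) (V v) = cinner h (V w))"
    proof
      assume L: "\<forall>u\<in>D'. cinner (T (V u)) (V v) = cinner (V u) (V w)"
      show "\<forall>h\<in>D. cinner (T h) (V v) = cinner h (V w)"
      proof
        fix h assume h: "h \<in> D"
        obtain u where "u \<in> carrier P" "V u = h" using pre by blast
        then show "cinner (T h) (V v) = cinner h (V w)" using L h by (auto simp: D')
      qed
    qed (simp add: D')
    also have "\<dots> \<longleftrightarrow> V v \<in> D \<and> T (V v) = V w" by (rule adj)
    also have "\<dots> \<longleftrightarrow> v \<in> D' \<and> T' v = w"
    proof (cases "v \<in> D'")
      case True
      then have "T' v = w \<longleftrightarrow> V (T' v) = V w" using eqI T'(1) w by metis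
      then show ?thesis using True T'(2) by (simp add: D')
    qed (use v in \<open>simp add: D'\<close>)
    finally show "(\<forall>u\<in>D'. ip P (T' u) v = ip P u w) \<longleftrightarrow> (v \<in> D' \<and> T' v = w)" .
  qed
qed

section \<open>Integration with respect to \<open>dF\<close>\<close>

text \<open>The operator function \<open>F(x) = \<psi> E\<^sub>x \<psi>\<^sup>*\<close>.\<close>

locale transformed_family = spectral_family E
  for E :: "real \<Rightarrow> 'h::complex_hilbert_space \<Rightarrow> 'h" +
  fixes \<psi> :: "'h \<Rightarrow> 'n::complex_hilbert_space" and F :: "real \<Rightarrow> 'n \<Rightarrow> 'n"
  assumes psi_clinear: "bounded_clinear \<psi>"
    and F_eq: "F x n = \<psi> (E x (cadjoint \<psi> n))"
begin

lemmas cinner_psi = cinner_cadjoint[OF psi_clinear]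

lemma adj_linear: "bounded_linear (cadjoint \<psi>)" and adj_scaleC: "cadjoint \<psi> (c *\<^sub>C n) = c *\<^sub>C cadjoint \<psi> n"
  using bounded_clinear_cadjoint[OF psi_clinear] by (auto simp: bounded_clinear_def)

lemmas adj_add = linear_add[OF bounded_linear.linear[OF adj_linear]]
lemmas adj_diff = linear_diff[OF bounded_linear.linear[OF adj_linear]]
lemmas adj_scaleR = linear_scale[OF bounded_linear.linear[OF adj_linear]]

lemma increment_F: "increment F K n = \<psi> (increment E K (cadjoint \<psi> n))"
  using psi_clinear linear_0[OF bounded_linear.linear, of \<psi>] linear_diff[OF bounded_linear.linear, of \<psi>]
  by (simp add: increment_def F_eq bounded_clinear_def)

text \<open>The Riemann--Stieltjes sum of \<open>\<integral> dE\<^sub>x \<psi>\<^sup>* f(x)\<close>.\<close>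

definition asum :: "(real \<Rightarrow> 'n) \<Rightarrow> (real \<times> real set) set \<Rightarrow> 'h" where
  "asum f = rsum (\<lambda>x. cadjoint \<psi> (f x))"

text \<open>Only for tagged divisions: there the product of the increments of \<open>E\<close> over two cells is the
  increment over their intersection.\<close>

lemma F_sum_eq:
  assumes "p tagged_division_of {a..b}" "q tagged_division_of {a..b}"
  shows "F_sum F f g p q = cinner (asum f p) (asum g q)"
  unfolding F_sum_def asum_def cinner_rsum_rsum[OF assms] by (simp add: increment_F cinner_psi)

lemma eventually_F_sum_eq:
  "eventually (\<lambda>(p, q). F_sum F f g p q = cinner (asum f p) (asum g q)) (rs_filter a b \<times>\<^sub>F rs_filter a b)"
  by (rule eventually_mono[OF eventually_prodI[OF eventually_rs_filter_tagged_division
      eventually_rs_filter_tagged_division]]) (auto simp: F_sum_eq)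

lemma has_F_integral_of_tendsto:
  assumes "(asum f \<longlongrightarrow> u) (rs_filter a b)" "(asum g \<longlongrightarrow> v) (rs_filter a b)"
  shows "has_F_integral F a b f g (cinner u v)"
proof -
  have "((\<lambda>z. cinner (asum f (fst z)) (asum g (snd z))) \<longlongrightarrow> cinner u v) (rs_filter a b \<times>\<^sub>F rs_filter a b)"
    by (intro cinner.tendsto filterlim_compose[OF assms(1) filterlim_fst] filterlim_compose[OF assms(2) filterlim_snd])
  moreover have "eventually (\<lambda>z. cinner (asum f (fst z)) (asum g (snd z)) = (case z of (p, q) \<Rightarrow> F_sum F f g p q))
      (rs_filter a b \<times>\<^sub>F rs_filter a b)"
    using eventually_F_sum_eq[of f g a b] by eventually_elim auto
  ultimately show ?thesis
    unfolding has_F_integral_def by (rule Lim_transform_eventually)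
qed

lemma F_integral_on_eq:
  assumes "(asum f \<longlongrightarrow> u) (rs_filter a b)" "(asum g \<longlongrightarrow> v) (rs_filter a b)"
  shows "F_integral_on F a b f g = cinner u v"
proof -
  have "rs_filter a b \<times>\<^sub>F rs_filter a b \<noteq> bot" by (simp add: prod_filter_eq_bot)
  then show ?thesis
    unfolding F_integral_on_def using has_F_integral_of_tendsto[OF assms]
    by (intro the_equality) (auto simp: has_F_integral_def intro: tendsto_unique)
qed

text \<open>For two independent partitions the number \<open>\<parallel>u\<^sub>p - u\<^sub>q\<parallel>\<^sup>2\<close>, where \<open>u\<^sub>p\<close> is the sum over \<open>p\<close>, is
  a combination of four of the inner products whose common limit is the \<open>dF\<close>-integral.\<close>

lemma tendsto_of_has_F_integral:
  assumes "has_F_integral F a b f f z"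
  shows "\<exists>u. (asum f \<longlongrightarrow> u) (rs_filter a b)"
proof (rule tendsto_of_cauchy_net)
  fix e :: real assume e: "e > 0"
  have "eventually (\<lambda>w. dist (case w of (p, q) \<Rightarrow> F_sum F f f p q) z < e\<^sup>2 / 4) (rs_filter a b \<times>\<^sub>F rs_filter a b)"
    using assms e unfolding has_F_integral_def by (intro tendstoD) auto
  then have "eventually (\<lambda>(p, q). dist (cinner (asum f p) (asum f q)) z < e\<^sup>2 / 4) (rs_filter a b \<times>\<^sub>F rs_filter a b)"
    using eventually_F_sum_eq[of f f a b] by eventually_elim auto
  then obtain P Q where PQ: "eventually P (rs_filter a b)" "eventually Q (rs_filter a b)"
    and close: "\<And>p q. P p \<Longrightarrow> Q q \<Longrightarrow> cmod (cinner (asum f p) (asum f q) - z) < e\<^sup>2 / 4"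
    unfolding eventually_prod_filter by (auto simp: dist_norm)
  have "dist (asum f p) (asum f q) < e" if "P p \<and> Q p" "P q \<and> Q q" for p q
  proof -
    let ?c = "\<lambda>p q. cinner (asum f p) (asum f q) - z"
    have "complex_of_real ((norm (asum f p - asum f q))\<^sup>2) = ?c p p - ?c p q - ?c q p + ?c q q"
      by (simp add: cinner_self[symmetric] cinner_diff_left cinner_diff_right del: of_real_power)
    then have "(norm (asum f p - asum f q))\<^sup>2 = cmod (?c p p - ?c p q - ?c q p + ?c q q)"
      by (metis abs_power2 norm_of_real real_norm_def)
    also have "\<dots> \<le> cmod (?c p p) + cmod (?c p q) + cmod (?c q p) + cmod (?c q q)"
      by (smt (verit) norm_triangle_ineq norm_triangle_ineq4)
    also have "\<dots> < e\<^sup>2"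
      using close[of p p] close[of p q] close[of q p] close[of q q] that by linarith
    finally show ?thesis
      using e by (simp add: dist_norm power_less_imp_less_base)
  qed
  then show "\<exists>P. eventually P (rs_filter a b) \<and> (\<forall>p q. P p \<and> P q \<longrightarrow> dist (asum f p) (asum f q) < e)"
    using eventually_conj[OF PQ] by blast
qed simp

text \<open>The vector \<open>y = \<integral> dE\<^sub>x \<psi>\<^sup>* f(x)\<close>.\<close>

definition has_vector_integral :: "(real \<Rightarrow> 'n) \<Rightarrow> 'h \<Rightarrow> bool" where
  "has_vector_integral f y \<longleftrightarrow> has_rs_integral (\<lambda>x K. increment E K (cadjoint \<psi> (f x))) y"

lemma has_vector_integral_iff:
  "has_vector_integral f y \<longleftrightarrow> (\<forall>a b. a < b \<longrightarrow> (asum f \<longlongrightarrow> increment E {a..b} y) (rs_filter a b))"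
  unfolding has_vector_integral_def has_rs_integral_iff asum_def ..

lemma has_vector_integral_tendsto:
  "has_vector_integral f y \<Longrightarrow> a < b \<Longrightarrow> (asum f \<longlongrightarrow> increment E {a..b} y) (rs_filter a b)"
  by (simp add: has_vector_integral_iff)

lemma has_vector_integral_unique: "has_vector_integral f y \<Longrightarrow> has_vector_integral f z \<Longrightarrow> y = z"
  unfolding has_vector_integral_def by (rule has_rs_integral_unique)

lemma V_pre_eq: "has_vector_integral f y \<Longrightarrow> V_pre E \<psi> f = y"
  unfolding V_pre_def has_vector_integral_def[symmetric]
  by (rule the_equality) (auto intro: has_vector_integral_unique)

lemma has_vector_integral_add:
  assumes "has_vector_integral f y" "has_vector_integral g z"
  shows "has_vector_integral (\<lambda>x. f x + g x) (y + z)"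
proof -
  have "asum (\<lambda>x. f x + g x) = (\<lambda>p. asum f p + asum g p)"
    by (simp add: fun_eq_iff asum_def adj_add rsum_add)
  then show ?thesis
    using assms by (simp add: has_vector_integral_iff increment_add tendsto_add)
qed

lemma has_vector_integral_scaleC:
  assumes "has_vector_integral f y"
  shows "has_vector_integral (\<lambda>x. c *\<^sub>C f x) (c *\<^sub>C y)"
proof -
  have "asum (\<lambda>x. c *\<^sub>C f x) = (\<lambda>p. c *\<^sub>C asum f p)"
    by (simp add: fun_eq_iff asum_def adj_scaleC rsum_scaleC)
  then show ?thesis
    using assms by (simp add: has_vector_integral_iff increment_scaleC tendsto_scaleC)
qed

text \<open>A function has finite norm if and only if its vector integral over the line exists.  From left to
  right, the integrals over bounded intervals exist by \<open>tendsto_of_has_F_integral\<close>, are consistent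
  under restriction, and have convergent norms.\<close>

lemma finite_norm_iff: "finite_norm F f \<longleftrightarrow> (\<exists>y. has_vector_integral f y)"
proof
  assume fin: "finite_norm F f"
  then have "\<forall>a b. a < b \<longrightarrow> (\<exists>u. (asum f \<longlongrightarrow> u) (rs_filter a b))"
    unfolding finite_norm_def using tendsto_of_has_F_integral by blast
  then obtain U where U: "\<And>a b. a < b \<Longrightarrow> (asum f \<longlongrightarrow> U a b) (rs_filter a b)"
    by metis
  obtain z where z: "((\<lambda>(a, b). F_integral_on F a b f f) \<longlongrightarrow> z) (at_bot \<times>\<^sub>F at_top)"
    using fin unfolding finite_norm_def by blast
  have "eventually (\<lambda>w. (case w of (a, b) \<Rightarrow> F_integral_on F a b f f)
      = (case w of (a, b) \<Rightarrow> complex_of_real ((norm (U a b))\<^sup>2))) (at_bot \<times>\<^sub>F at_top)"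
    using eventually_interval_contains[of 0 1]
    by eventually_elim (auto simp: F_integral_on_eq[OF U U] cinner_self)
  then have "((\<lambda>(a, b). complex_of_real ((norm (U a b))\<^sup>2)) \<longlongrightarrow> z) (at_bot \<times>\<^sub>F at_top)"
    using z by (rule Lim_transform_eventually[rotated])
  then have "\<exists>y. \<forall>a b. a < b \<longrightarrow> U a b = increment E {a..b} y"
    by (rule consistent_family_vector_of_norm_limit[rotated])
      (rule increment_integral_restrict[OF _ _ _ U[unfolded asum_def] U[unfolded asum_def]], auto)
  then show "\<exists>y. has_vector_integral f y"
    using U unfolding has_vector_integral_iff by metis
next
  assume "\<exists>y. has_vector_integral f y"
  then obtain y where y: "has_vector_integral f y" ..
  note U = has_vector_integral_tendsto[OF y]
  have "eventually (\<lambda>w. (case w of (a, b) \<Rightarrow> complex_of_real ((norm (increment E {a..b} y))\<^sup>2))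
      = (case w of (a, b) \<Rightarrow> F_integral_on F a b f f)) (at_bot \<times>\<^sub>F at_top)"
    using eventually_interval_contains[of 0 1]
    by eventually_elim (auto simp: F_integral_on_eq[OF U U] cinner_self)
  then have "((\<lambda>(a, b). F_integral_on F a b f f) \<longlongrightarrow> complex_of_real ((norm y)\<^sup>2)) (at_bot \<times>\<^sub>F at_top)"
    by (rule Lim_transform_eventually[OF tendsto_norm_increment_sq])
  then show "finite_norm F f"
    unfolding finite_norm_def using has_F_integral_of_tendsto[OF U U] by blast
qed

lemma F_integral_eq:
  assumes f: "has_vector_integral f y" and g: "has_vector_integral g z"
  shows "F_integral F f g = cinner y z"
proof -
  note lim = has_vector_integral_tendsto
  have "((\<lambda>w. cinner (case w of (a, b) \<Rightarrow> increment E {a..b} y) (case w of (a, b) \<Rightarrow> increment E {a..b} z))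
      \<longlongrightarrow> cinner y z) (at_bot \<times>\<^sub>F at_top)"
    by (intro cinner.tendsto tendsto_increment_UNIV)
  moreover have "eventually (\<lambda>w. cinner (case w of (a, b) \<Rightarrow> increment E {a..b} y) (case w of (a, b) \<Rightarrow> increment E {a..b} z)
      = (case w of (a, b) \<Rightarrow> F_integral_on F a b f g)) (at_bot \<times>\<^sub>F at_top)"
    using eventually_interval_contains[of 0 1]
    by eventually_elim (auto simp: F_integral_on_eq[OF lim[OF f] lim[OF g]])
  ultimately have "((\<lambda>(a, b). F_integral_on F a b f g) \<longlongrightarrow> cinner y z) (at_bot \<times>\<^sub>F at_top)"
    by (rule Lim_transform_eventually)
  then show ?thesis
    unfolding F_integral_def by (rule tendsto_Lim[OF at_bot_at_top_neq_bot])
qed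

lemma carrier_C_space: "f \<in> carrier (C_space F) \<longleftrightarrow> continuous_on UNIV f \<and> (\<exists>y. has_vector_integral f y)"
  by (simp add: C_space_def finite_norm_iff)

lemma has_vector_integral_V_pre: "f \<in> carrier (C_space F) \<Longrightarrow> has_vector_integral f (V_pre E \<psi> f)"
  unfolding carrier_C_space using V_pre_eq by metis

text \<open>So the integral is a linear isometry of the continuous functions of finite norm into \<open>H\<close>, and
  \<open>V\<close> is its extension to the completion.\<close>

sublocale C: isometric_map "C_space F" "V_pre E \<psi>"
proof
  fix u v c assume u: "u \<in> carrier (C_space F)"
  note hu = has_vector_integral_V_pre[OF u]
  have scale: "has_vector_integral (vscale (C_space F) c u) (c *\<^sub>C V_pre E \<psi> u)"
    unfolding C_space_def by (simp add: has_vector_integral_scaleC[OF hu])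
  show "V_pre E \<psi> (vscale (C_space F) c u) = c *\<^sub>C V_pre E \<psi> u"
    by (rule V_pre_eq[OF scale])
  have "continuous_on UNIV (vscale (C_space F) c u)"
    using u bounded_linear.continuous_on[OF bounded_linear_scaleC, of UNIV u c]
    unfolding carrier_C_space by (simp add: C_space_def)
  then show "vscale (C_space F) c u \<in> carrier (C_space F)"
    using scale carrier_C_space by blast
  assume v: "v \<in> carrier (C_space F)"
  note hv = has_vector_integral_V_pre[OF v]
  have add: "has_vector_integral (vadd (C_space F) u v) (V_pre E \<psi> u + V_pre E \<psi> v)"
    unfolding C_space_def by (simp add: has_vector_integral_add[OF hu hv])
  show "V_pre E \<psi> (vadd (C_space F) u v) = V_pre E \<psi> u + V_pre E \<psi> v"
    by (rule V_pre_eq[OF add])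
  have "continuous_on UNIV (vadd (C_space F) u v)"
    using u v unfolding carrier_C_space by (simp add: C_space_def continuous_on_add)
  then show "vadd (C_space F) u v \<in> carrier (C_space F)"
    using add carrier_C_space by blast
  show "ip (C_space F) u v = cinner (V_pre E \<psi> u) (V_pre E \<psi> v)"
    using F_integral_eq[OF hu hv] by (simp add: C_space_def)
qed

lemma V_op_eq_extension: "V_op E \<psi> = C.extension"
  by (intro ext) (simp add: V_op_def C.extension_def)

end

section \<open>The unitary equivalence\<close>

text \<open>A vector of \<open>G\<close> is its projection onto the closed range of \<open>\<psi>\<^sup>*\<close>: the remainder lies in the
  kernel of \<open>\<psi>\<close>, which is orthogonal to \<open>G\<close>.\<close>

lemma generating_in_range_adjoint:
  fixes \<psi> :: "'h::complex_hilbert_space \<Rightarrow> 'n::complex_hilbert_space"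
  assumes \<psi>: "bounded_clinear \<psi>" and ker: "{h. \<psi> h = 0} = orth_compl G"
    and S: "bounded_clinear S" "\<And>n. S (cadjoint \<psi> n) = n" and g: "g \<in> G"
  shows "\<exists>n. g = cadjoint \<psi> n"
proof -
  let ?A = "cadjoint \<psi>"
  have A: "bounded_linear ?A" and A_sc: "\<And>c n. ?A (c *\<^sub>C n) = c *\<^sub>C ?A n"
    using bounded_clinear_cadjoint[OF \<psi>] by (auto simp: bounded_clinear_def)
  have S': "bounded_linear S" using S(1) by (simp add: bounded_clinear_def)
  have "csubspace (range ?A)"
    unfolding csubspace_def
  proof (intro conjI ballI allI)
    show "0 \<in> range ?A" using linear_0[OF bounded_linear.linear[OF A]] by (metis rangeI)
    show "x + y \<in> range ?A" if "x \<in> range ?A" "y \<in> range ?A" for x y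
      using that by (auto simp: linear_add[OF bounded_linear.linear[OF A], symmetric])
    show "c *\<^sub>C x \<in> range ?A" if "x \<in> range ?A" for c x
      using that by (auto simp: A_sc[symmetric])
  qed
  moreover have "closed (range ?A)"
    unfolding closed_sequential_limits
  proof (intro allI impI, elim conjE)
    fix X l assume X: "\<forall>n. X n \<in> range ?A" and l: "X \<longlonglongrightarrow> l"
    have "(\<lambda>n. ?A (S (X n))) \<longlonglongrightarrow> ?A (S l)"
      by (intro bounded_linear.tendsto[OF A] bounded_linear.tendsto[OF S'] l)
    moreover have "?A (S (X n)) = X n" for n
    proof -
      obtain m where "X n = ?A m" using X by blast
      then show ?thesis by (simp add: S(2))
    qed
    ultimately have "l = ?A (S l)" using l LIMSEQ_unique by simp
    then show "l \<in> range ?A" by (metis rangeI)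
  qed
  ultimately obtain r where r: "r \<in> range ?A" and orth: "\<And>y. y \<in> range ?A \<Longrightarrow> cinner (g - r) y = 0"
    using orthogonal_projection_exists[of "range ?A" g] by blast
  have "cinner (\<psi> (g - r)) n = 0" for n
    using orth[of "?A n"] by (simp add: cinner_cadjoint[OF \<psi>])
  then have "\<psi> (g - r) = 0" using cinner_eq_zero_iff by blast
  then have "g - r \<in> orth_compl G" using ker by blast
  then have "cinner (g - r) g = 0" using g by (simp add: orth_compl_def)
  then have "cinner (g - r) (g - r) = 0" using orth[OF r] by (simp add: cinner_diff_right)
  then have "g = r" by simp
  then show ?thesis using r by blast
qed

context transformed_family
begin

lemma cutoff_integral_in_range:
  assumes \<delta>: "\<delta> > 0" and y: "has_rs_integral (\<lambda>x K. increment E K (cutoff b \<delta> x *\<^sub>R cadjoint \<psi> n)) y"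
  shows "y \<in> V_pre E \<psi> ` carrier (C_space F)"
proof -
  let ?f = "\<lambda>x. cutoff b \<delta> x *\<^sub>R n"
  have v: "has_vector_integral ?f y"
    unfolding has_vector_integral_def using y by (simp add: adj_scaleR)
  have "continuous_on UNIV ?f"
    unfolding cutoff_def by (intro continuous_intros) (use \<delta> in auto)
  then have "?f \<in> carrier (C_space F)" using v carrier_C_space by blast
  then show ?thesis using V_pre_eq[OF v] by (metis imageI)
qed

text \<open>The range is a subspace whose closure contains all \<open>E\<^sub>b g\<close> with \<open>g \<in> G\<close>.\<close>

lemma V_pre_dense:
  assumes "generating_subspace E G" and "{h. \<psi> h = 0} = orth_compl G"
    and "bounded_clinear S" "\<And>n. S (cadjoint \<psi> n) = n"
  shows "closure (V_pre E \<psi> ` carrier (C_space F)) = UNIV"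
proof (rule generating_subspace_dense[OF assms(1)])
  let ?R = "V_pre E \<psi> ` carrier (C_space F)"
  have "csubspace ?R"
    unfolding csubspace_def
  proof (intro conjI ballI allI)
    have "asum (\<lambda>_. 0) = (\<lambda>_. 0)"
      by (simp add: fun_eq_iff asum_def rsum_def case_prod_beta linear_0[OF bounded_linear.linear[OF adj_linear]])
    then have "has_vector_integral (\<lambda>_. 0) 0"
      by (simp add: has_vector_integral_iff)
    then have "(\<lambda>_. 0) \<in> carrier (C_space F)" "V_pre E \<psi> (\<lambda>_. 0) = 0"
      using carrier_C_space V_pre_eq by auto
    then show "0 \<in> ?R" by force
    show "x + y \<in> ?R" if "x \<in> ?R" "y \<in> ?R" for x y
      using that by (auto simp: C.W_vadd[symmetric] intro!: imageI C.vadd_closed)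
    show "c *\<^sub>C x \<in> ?R" if "x \<in> ?R" for c x
      using that by (auto simp: C.W_vscale[symmetric] intro!: imageI C.vscale_closed)
  qed
  then show "csubspace (closure ?R)" by (rule csubspace_closure)
  fix x h assume "h \<in> G"
  then obtain n where h: "h = cadjoint \<psi> n"
    using generating_in_range_adjoint[OF psi_clinear assms(2-4)] by blast
  show "E x h \<in> closure ?R"
    unfolding h by (rule E_in_closed) (use cutoff_integral_in_range closure_subset in blast)+
qed simp

text \<open>In terms of the images under \<open>V\<close>, multiplication by \<open>x\<close> is described in the same way as the
  operator \<open>T\<close>.\<close>

lemma is_x_times_iff:
  assumes A: "A \<in> carrier (L2_space F)" and B: "B \<in> carrier (L2_space F)"
  shows "is_x_times F A B \<longleftrightarrow>
    (\<forall>a b. a < b \<longrightarrow> mult_op (\<lambda>x. x) a b (V_op E \<psi> A) = increment E {a..b} (V_op E \<psi> B))"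
proof -
  let ?W = "V_pre E \<psi>" and ?V = "V_op E \<psi>"
  \<comment> \<open>the limit, over the interval from \<open>a\<close> to \<open>b\<close>, of the vector integrals of \<open>Y\<^sub>n(x) - x X\<^sub>n(x)\<close>\<close>
  define d where "d a b = increment E {a..b} (?V B) - mult_op (\<lambda>x. x) a b (?V A)" for a b
  have lim: "(\<lambda>n. F_integral_on F a b (\<lambda>x. Y n x - x *\<^sub>R X n x) (\<lambda>x. Y n x - x *\<^sub>R X n x))
      \<longlonglongrightarrow> complex_of_real ((norm (d a b))\<^sup>2)"
    if ab: "a < b" and X: "X \<in> A" and Y: "Y \<in> B" for a b X Y
  proof -
    have id: "continuous_on {a..b} (\<lambda>x::real. x)" by (rule continuous_on_id)
    have ab': "a \<le> b" using ab by simp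
    note X = C.tendsto_extension[OF A[unfolded L2_space_def] X, folded V_op_eq_extension]
    note Y = C.tendsto_extension[OF B[unfolded L2_space_def] Y, folded V_op_eq_extension]
    let ?d = "\<lambda>n. increment E {a..b} (?W (Y n)) - mult_op (\<lambda>x. x) a b (?W (X n))"
    have "(asum (\<lambda>x. Y n x - x *\<^sub>R X n x) \<longlongrightarrow> ?d n) (rs_filter a b)" for n
    proof -
      have "asum (\<lambda>x. Y n x - x *\<^sub>R X n x)
          = (\<lambda>p. asum (Y n) p - rsum (\<lambda>x. x *\<^sub>R cadjoint \<psi> (X n x)) p)"
        by (simp add: fun_eq_iff asum_def adj_diff adj_scaleR rsum_diff)
      moreover have "(rsum (\<lambda>x. x *\<^sub>R cadjoint \<psi> (X n x)) \<longlongrightarrow> mult_op (\<lambda>x. x) a b (?W (X n))) (rs_filter a b)"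
        using tendsto_rsum_scaleR[OF ab' id
            has_vector_integral_tendsto[OF has_vector_integral_V_pre[OF X(1)] ab, unfolded asum_def]]
        by (simp add: mult_increment[OF ab' id])
      ultimately show ?thesis
        using has_vector_integral_tendsto[OF has_vector_integral_V_pre[OF Y(1)] ab]
        by (simp add: tendsto_diff)
    qed
    note diff = this
    have "F_integral_on F a b (\<lambda>x. Y n x - x *\<^sub>R X n x) (\<lambda>x. Y n x - x *\<^sub>R X n x)
        = complex_of_real ((norm (?d n))\<^sup>2)" for n
      by (simp only: F_integral_on_eq[OF diff diff] cinner_self)
    moreover have "(\<lambda>n. complex_of_real ((norm (?d n))\<^sup>2)) \<longlonglongrightarrow> complex_of_real ((norm (d a b))\<^sup>2)"
      unfolding d_def
      by (intro tendsto_of_real tendsto_power tendsto_norm tendsto_diff tendsto_increment Y(2)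
          bounded_linear.tendsto[OF bounded_linear_mult[OF ab' id]] X(2))
    ultimately show ?thesis by simp
  qed
  obtain X Y where XY: "X \<in> A" "Y \<in> B"
    using C.completion_nonempty A B unfolding L2_space_def by blast
  have "is_x_times F A B \<longleftrightarrow> (\<forall>a b. a < b \<longrightarrow> d a b = 0)"
  proof
    assume x: "is_x_times F A B"
    show "\<forall>a b. a < b \<longrightarrow> d a b = 0"
    proof (intro allI impI)
      fix a b :: real assume ab: "a < b"
      have "complex_of_real ((norm (d a b))\<^sup>2) = 0"
        using x XY ab LIMSEQ_unique[OF lim[OF ab XY]] unfolding is_x_times_def by blast
      then show "d a b = 0" by simp
    qed
  next
    assume "\<forall>a b. a < b \<longrightarrow> d a b = 0"
    then show "is_x_times F A B"
      unfolding is_x_times_def using lim by force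
  qed
  then show ?thesis by (auto simp: d_def)
qed

end

theorem theorem2p1:
  fixes T :: "'h::complex_hilbert_space \<Rightarrow> 'h" and D_T :: "'h set"
    and E :: "real \<Rightarrow> 'h \<Rightarrow> 'h" and G :: "'h set"
    and \<psi> :: "'h \<Rightarrow> 'n::complex_hilbert_space" and F :: "real \<Rightarrow> 'n \<Rightarrow> 'n"
  assumes "separable_space (euclidean :: 'h topology)"
    and "self_adjoint whole_space D_T T"
    and "resolution_of_operator E D_T T"
    and "generating_subspace E G"
    and "same_hilbert_dim (UNIV :: 'n set) G"
    and "bounded_clinear \<psi>" and "surj \<psi>"
    and "{h. \<psi> h = 0} = orth_compl G"
    and "\<exists>S. bounded_clinear S \<and> (\<forall>n. S (cadjoint \<psi> n) = n)"
    and "\<forall>x n. F x n = \<psi> (E x (cadjoint \<psi> n))"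
  shows "(\<forall>f\<in>carrier (C_space F).
            has_rs_integral (\<lambda>x K. increment E K (cadjoint \<psi> (f x)))
              (V_op E \<psi> (completion_emb (C_space F) f))) \<and>
         unitary_iso (L2_space F) whole_space (V_op E \<psi>) \<and>
         self_adjoint (L2_space F) (Q_dom F) (Q_op F) \<and>
         Q_dom F = {f \<in> carrier (L2_space F). V_op E \<psi> f \<in> D_T} \<and>
         (\<forall>f\<in>Q_dom F. V_op E \<psi> (Q_op F f) = T (V_op E \<psi> f))"
proof -
  obtain S where S: "bounded_clinear S" "\<And>n. S (cadjoint \<psi> n) = n" using assms(9) by blast
  interpret transformed_family E \<psi> F
    by standard (use assms in \<open>auto simp: resolution_of_operator_def\<close>)
  let ?V = "V_op E \<psi>" and ?L = "L2_space F"
  have unitary: "unitary_iso ?L whole_space ?V"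
    unfolding L2_space_def V_op_eq_extension
    by (rule C.unitary_extension[OF V_pre_dense[OF assms(4,8) S]])
  then have inj: "inj_on ?V (carrier ?L)" and onto: "?V ` carrier ?L = UNIV"
    by (auto simp: unitary_iso_def whole_space_def bij_betw_def)
  have x_times: "is_x_times F A B \<longleftrightarrow> ?V A \<in> D_T \<and> T (?V A) = ?V B"
    if "A \<in> carrier ?L" "B \<in> carrier ?L" for A B
    using is_x_times_iff[OF that] resolution_of_operator_iff[OF assms(3)] by simp
  have pre: "\<exists>B\<in>carrier ?L. ?V B = h" for h using onto by (metis UNIV_I imageE)
  have dom: "Q_dom F = {A \<in> carrier ?L. ?V A \<in> D_T}"
    unfolding Q_dom_def using x_times pre by (auto, metis)
  have Q: "Q_op F A \<in> carrier ?L" "?V (Q_op F A) = T (?V A)" if A: "A \<in> Q_dom F" for A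
  proof -
    have A': "A \<in> carrier ?L" "?V A \<in> D_T" using A dom by auto
    obtain B where B: "B \<in> carrier ?L" "?V B = T (?V A)" using pre by blast
    have "Q_op F A = B"
      unfolding Q_op_def
    proof (rule the_equality)
      show "B \<in> carrier ?L \<and> is_x_times F A B" using A' B x_times by simp
      fix B' assume B': "B' \<in> carrier ?L \<and> is_x_times F A B'"
      then have "?V B' = ?V B" using A' B x_times[of A B'] by simp
      then show "B' = B" using inj_onD[OF inj] B' B by blast
    qed
    then show "Q_op F A \<in> carrier ?L" "?V (Q_op F A) = T (?V A)" using B by auto
  qed
  have sa: "self_adjoint ?L (Q_dom F) (Q_op F)"
    by (rule self_adjoint_unitary_transfer[OF unitary _ _ assms(2) dom Q])
      (auto simp: L2_space_def C.completion_closed)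
  have "has_rs_integral (\<lambda>x K. increment E K (cadjoint \<psi> (f x))) (?V (completion_emb (C_space F) f))"
    if "f \<in> carrier (C_space F)" for f
    using has_vector_integral_V_pre[OF that] C.extension_emb[OF that]
    by (simp add: has_vector_integral_def V_op_eq_extension)
  then show ?thesis using unitary sa dom Q by blast
qed

end
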